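(* Let $u:\mathbb{D}\to\mathbb{D}$ be a $T_2$-harmonic function. Then $$\|D_u(z)\|\leq \frac{(2+5|z|)(1+|z|^2)}{1-|z|^2}\quad\text{for all } z\in\mathbb{D},$$ and $$\|D_u(0)\|\leq \frac{4}{\pi}.$$ Moreover, the inequality $\|D_u(0)\|\leq \frac4\pi$ is sharp (the constant $\frac{4}{\pi}$ cannot be replaced by a smaller one valid for all $T_2$-harmonic $u:\mathbb{D}\to\mathbb{D}$).
   Context: $\mathbb{D}=\{z\in\mathbb{C}:|z|<1\}$ is the open unit disk. For $\alpha\in\mathbb{R}$, a complex-valued function $u\in\mathcal{C}^2(\mathbb{D})$ is called $T_\alpha$-harmonic if $T_\alpha(u)=0$ in $\mathbb{D}$, where $$T_\alpha=-\frac{\alpha^2}{4}(1-|z|^2)^{-(\alpha+1)}+\frac12 L_\alpha+\frac12\overline{L_\alpha},\qquad L_\alpha=\frac{\partial}{\partial\overline z}(1-|z|^2)^{-\alpha}\frac{\partial}{\partial z},\qquad \overline{L_\alpha}=\frac{\partial}{\partial z}(1-|z|^2)^{-\alpha}\frac{\partial}{\partial \overline z},$$ with $\frac{\partial}{\partial z}=\frac12(\partial_x-i\partial_y)$ and $\frac{\partial}{\partial\overline z}=\frac12(\partial_x+i\partial_y)$ for $z=x+iy$; the first term of $T_\alpha$ is multiplication by the given function. $T_2$-harmonic means the case $\alpha=2$. $D_u$ is the real $2\times2$ Jacobian matrix of $u$ and $\|A\|=\sup\{|Az|:|z|=1\}$, so that $\|D_u\|=|u_z|+|u_{\overline z}|$.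 *)

theory Defs
  imports "HOL-Analysis.Analysis"
begin

text \<open>
  Differentiability is over the reals throughout: the predicate \<open>differentiable\<close> and
  \<open>frechet_derivative\<close> treat \<open>complex\<close> as a real normed space, so that
  \<open>frechet_derivative u (at z)\<close> is the real-linear map given by the Jacobian matrix
  \<open>D\<^sub>u(z)\<close>, and \<open>onorm\<close> of it is the operator norm of that matrix for the Euclidean norm.
\<close>

definition partial_x :: "(complex \<Rightarrow> complex) \<Rightarrow> complex \<Rightarrow> complex" where
  "partial_x u z = frechet_derivative u (at z) 1"

definition partial_y :: "(complex \<Rightarrow> complex) \<Rightarrow> complex \<Rightarrow> complex" where
  "partial_y u z = frechet_derivative u (at z) \<i>"

definition d_z :: "(complex \<Rightarrow> complex) \<Rightarrow> complex \<Rightarrow> complex" where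
  "d_z u z = (partial_x u z - \<i> * partial_y u z) / 2"

definition d_zbar :: "(complex \<Rightarrow> complex) \<Rightarrow> complex \<Rightarrow> complex" where
  "d_zbar u z = (partial_x u z + \<i> * partial_y u z) / 2"

text \<open>The two predicates below are meant for open sets \<open>S\<close>.\<close>

definition C1_class :: "complex set \<Rightarrow> (complex \<Rightarrow> complex) \<Rightarrow> bool" where
  "C1_class S u \<longleftrightarrow>
     (\<forall>z\<in>S. u differentiable (at z)) \<and>
     continuous_on S (partial_x u) \<and> continuous_on S (partial_y u)"

definition C2_class :: "complex set \<Rightarrow> (complex \<Rightarrow> complex) \<Rightarrow> bool" where
  "C2_class S u \<longleftrightarrow> C1_class S u \<and> C1_class S (partial_x u) \<and> C1_class S (partial_y u)"

definition L_op :: "real \<Rightarrow> (complex \<Rightarrow> complex) \<Rightarrow> complex \<Rightarrow> complex" where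
  "L_op \<alpha> u = d_zbar (\<lambda>w. of_real ((1 - (norm w)\<^sup>2) powr (-\<alpha>)) * d_z u w)"

definition Lbar_op :: "real \<Rightarrow> (complex \<Rightarrow> complex) \<Rightarrow> complex \<Rightarrow> complex" where
  "Lbar_op \<alpha> u = d_z (\<lambda>w. of_real ((1 - (norm w)\<^sup>2) powr (-\<alpha>)) * d_zbar u w)"

definition T_op :: "real \<Rightarrow> (complex \<Rightarrow> complex) \<Rightarrow> complex \<Rightarrow> complex" where
  "T_op \<alpha> u z =
     - of_real (\<alpha>\<^sup>2 / 4 * (1 - (norm z)\<^sup>2) powr (-(\<alpha> + 1))) * u z
     + (1 / 2) * L_op \<alpha> u z + (1 / 2) * Lbar_op \<alpha> u z"

definition T_harmonic :: "real \<Rightarrow> (complex \<Rightarrow> complex) \<Rightarrow> bool" where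
  "T_harmonic \<alpha> u \<longleftrightarrow> C2_class (ball 0 1) u \<and> (\<forall>z\<in>ball 0 1. T_op \<alpha> u z = 0)"

end

theory Submission
  imports Defs "HOL-Complex_Analysis.Cauchy_Integral_Formula" "HOL-Computational_Algebra.Polynomial"
begin

text \<open>
  For \<open>\<alpha> = 2\<close> the equation \<open>T\<^sub>\<alpha> u = 0\<close> reads \<open>(1 - |z|\<^sup>2) \<Delta>u / 4 + x u\<^sub>x + y u\<^sub>y = u\<close> with \<open>z = x + \<i> y\<close>.
  Its Poisson kernel is \<open>P(z, \<zeta>) = (1 - |z|\<^sup>2)\<^sup>3 / (2 |\<zeta> - z| ^ 4)\<close>. If \<open>u\<close> is the Poisson integral of a
  function bounded by 1, then \<open>|D u(z) h|\<close> is at most the mean of \<open>|D\<^sub>z P(z, \<zeta>) h|\<close> over the unit circle. The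
  integrand is pointwise at most \<open>(2 + 5 |z|) |h|\<close> times \<open>2 P(z, \<zeta>) / (1 - |z|\<^sup>2)\<close>, and the mean of \<open>P(z, \<zeta>)\<close> is
  \<open>(1 + |z|\<^sup>2) / 2\<close>; this is the general bound. At the origin the integrand is \<open>2 |Re (cnj \<zeta> h)|\<close>, whose mean is
  \<open>4 |h| / \<pi>\<close>. For the boundary values \<open>sgn (Re \<zeta>)\<close> this mean is attained, and the Poisson integrals of
  trigonometric polynomials close to them show that the constant is best possible
  (\<open>near_extremal_exists\<close>).

  A solution on the open disk has no boundary function to start with. Instead, the estimate for \<open>u\<close> is
  obtained as a limit of estimates for Poisson integrals (\<open>T_harmonic_2_approximation\<close>,
  \<open>T_harmonic_2_oscillation\<close>). The equation separates: for each integer \<open>k\<close> it has a solution \<open>T2_mode k\<close> that is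
  a multiple of the character \<open>\<zeta> powi k\<close> on every circle about the origin, and this solution is the Poisson
  integral of \<open>\<zeta> powi k\<close> by Cauchy's formula (\<open>circle_mean_poisson_powi\<close>). On a circle of radius \<open>R\<close>
  close to 1, \<open>u\<close> is uniformly close to a trigonometric polynomial; its extension by modes is close to \<open>u\<close>
  inside by the maximum principle (\<open>T_harmonic_2_maximum_principle\<close>), and for \<open>R\<close> near 1 this extension is
  close, on each smaller disk, to the Poisson integral of the same trigonometric polynomial on the unit
  circle.

  The approximation controls the functions and says nothing about their derivatives. Therefore it is the oscillation \<open>u z - u w\<close> that is bounded in the limit, by the mean of
  \<open>|P(z, \<zeta>) - P(w, \<zeta>)|\<close>, and the derivative bound follows by letting \<open>w\<close> tend to \<open>z\<close>
  (\<open>T_harmonic_2_derivative_bound\<close>).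
\<close>

section \<open>Wirtinger derivatives\<close>

text \<open>
  The pair \<open>(p, q)\<close> encodes the real-linear derivative of \<open>u\<close> at \<open>z\<close>. Working with it instead of
  \<open>partial_x\<close> and \<open>partial_y\<close> keeps all calculations in \<open>z\<close> and \<open>cnj z\<close>.
\<close>
definition wirtinger :: "(complex \<Rightarrow> complex) \<Rightarrow> complex \<Rightarrow> complex \<Rightarrow> complex \<Rightarrow> bool" where
  "wirtinger u p q z \<longleftrightarrow> (u has_derivative (\<lambda>h. p * h + q * cnj h)) (at z)"

lemma wirtinger_partials:
  assumes "wirtinger u p q z"
  shows "u differentiable (at z)" "frechet_derivative u (at z) = (\<lambda>h. p * h + q * cnj h)"
    "partial_x u z = p + q" "partial_y u z = \<i> * (p - q)" "d_z u z = p" "d_zbar u z = q"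
proof -
  show "u differentiable (at z)"
    using assms unfolding wirtinger_def differentiable_def by blast
  show F: "frechet_derivative u (at z) = (\<lambda>h. p * h + q * cnj h)"
    using assms frechet_derivative_at unfolding wirtinger_def by metis
  show "partial_x u z = p + q" "partial_y u z = \<i> * (p - q)" "d_z u z = p" "d_zbar u z = q"
    unfolding partial_x_def partial_y_def d_z_def d_zbar_def F by (auto simp: algebra_simps)
qed

lemma differentiable_wirtinger:
  assumes "u differentiable (at z)"
  shows "wirtinger u (d_z u z) (d_zbar u z) z"
proof -
  define F where "F = frechet_derivative u (at z)"
  have D: "(u has_derivative F) (at z)"
    using assms unfolding F_def by (simp add: frechet_derivative_works)
  interpret F: linear F
    using D has_derivative_linear by blast
  have "F h = d_z u z * h + d_zbar u z * cnj h" for h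
  proof -
    have "h = Re h *\<^sub>R 1 + Im h *\<^sub>R \<i>" by (simp add: complex_eq_iff)
    hence "F h = Re h *\<^sub>R F 1 + Im h *\<^sub>R F \<i>"
      by (metis F.add F.scale)
    thus ?thesis
      unfolding d_z_def d_zbar_def partial_x_def partial_y_def F_def[symmetric]
      by (simp add: complex_eq_iff field_simps)
  qed
  hence "F = (\<lambda>h. d_z u z * h + d_zbar u z * cnj h)" by auto
  with D show ?thesis unfolding wirtinger_def by simp
qed

lemma wirtinger_const: "wirtinger (\<lambda>w. c) 0 0 z"
  and wirtinger_ident: "wirtinger (\<lambda>w. w) 1 0 z"
  unfolding wirtinger_def by (auto intro!: derivative_eq_intros)

lemma wirtinger_cnj: "wirtinger u p q z \<Longrightarrow> wirtinger (\<lambda>w. cnj (u w)) (cnj q) (cnj p) z"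
  unfolding wirtinger_def by (drule has_derivative_cnj) (simp add: add.commute)

lemma wirtinger_add:
  "wirtinger u p q z \<Longrightarrow> wirtinger u' p' q' z \<Longrightarrow>
     wirtinger (\<lambda>w. u w + u' w) (p + p') (q + q') z"
  unfolding wirtinger_def by (drule (1) has_derivative_add) (simp add: algebra_simps)

lemma wirtinger_mult:
  "wirtinger u p q z \<Longrightarrow> wirtinger u' p' q' z \<Longrightarrow>
     wirtinger (\<lambda>w. u w * u' w) (u z * p' + p * u' z) (u z * q' + q * u' z) z"
  unfolding wirtinger_def by (drule (1) has_derivative_mult) (simp add: algebra_simps)

lemma wirtinger_cmult: "wirtinger u p q z \<Longrightarrow> wirtinger (\<lambda>w. k * u w) (k * p) (k * q) z"
  using wirtinger_mult[OF wirtinger_const] by force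

lemma wirtinger_cong:
  assumes "wirtinger u p q z" "open S" "z \<in> S" "\<And>w. w \<in> S \<Longrightarrow> v w = u w"
  shows "wirtinger v p q z"
  using assms has_derivative_transform_within_open[of u _ z UNIV S v] unfolding wirtinger_def
  by auto

text \<open>
  The derivatives of the factor \<open>(1 - |z|\<^sup>2)\<^sup>-\<^sup>2\<close> that \<open>L_op 2\<close> and \<open>Lbar_op 2\<close> differentiate. On the disk the
  real power is the square of an inverse, to which the chain rule applies.
\<close>
lemma wirtinger_weight:
  assumes "norm z < 1"
  shows "wirtinger (\<lambda>w. of_real ((1 - (norm w)\<^sup>2) powr (-2)))
           (2 * cnj z / (1 - (norm z)\<^sup>2) ^ 3) (2 * z / (1 - (norm z)\<^sup>2) ^ 3) z"
proof -
  define N where "N = 1 - (norm z)\<^sup>2"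
  have N: "N > 0" unfolding N_def using assms by (simp add: power_less_one_iff abs_square_less_1)
  have nz: "1 - z * cnj z \<noteq> 0"
    using N unfolding N_def complex_norm_square[symmetric]
    by (metis less_irrefl of_real_1 of_real_diff of_real_eq_0_iff)
  have w1: "wirtinger (\<lambda>w. 1 + (- 1) * (w * cnj w)) (- cnj z) (- z) z"
    using wirtinger_add[OF wirtinger_const[of 1] wirtinger_mult[OF wirtinger_const[of "-1"]
          wirtinger_mult[OF wirtinger_ident wirtinger_cnj[OF wirtinger_ident]]], of z]
    by simp
  have inv: "((\<lambda>w. inverse (w ^ 2)) has_field_derivative (- 2 / w ^ 3)) (at w)"
    if "w \<noteq> 0" for w :: complex
    using that by (auto intro!: derivative_eq_intros simp: field_simps power2_eq_square power3_eq_cube)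
  have w2: "wirtinger (\<lambda>w. inverse ((1 + (- 1) * (w * cnj w)) ^ 2))
     (2 * cnj z / (1 - z * cnj z) ^ 3) (2 * z / (1 - z * cnj z) ^ 3) z"
    unfolding wirtinger_def
    by (rule has_derivative_eq_rhs[OF has_derivative_compose[OF w1[unfolded wirtinger_def]
        inv[unfolded has_field_derivative_def, of "1 + (- 1) * (z * cnj z)"]]])
      (use nz in \<open>auto simp: fun_eq_iff diff_divide_distrib add_divide_distrib algebra_simps\<close>)
  have *: "of_real ((1 - (norm w)\<^sup>2) powr (-2)) = inverse ((1 + (- 1) * (w * cnj w)) ^ 2)"
    if "w \<in> ball 0 1" for w :: complex
  proof -
    have "1 - (norm w)\<^sup>2 > 0" using that by (simp add: power_less_one_iff abs_square_less_1)
    hence "(1 - (norm w)\<^sup>2) powr (-2) = inverse ((1 - (norm w)\<^sup>2) ^ 2)"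
      by (simp add: powr_minus)
    thus ?thesis by (simp add: complex_norm_square[symmetric])
  qed
  show ?thesis
    by (rule wirtinger_cong[OF _ open_ball[of 0 1] _ *])
      (use w2 assms in \<open>auto simp: complex_norm_square[symmetric]\<close>)
qed

section \<open>The differential equation\<close>

text \<open>
  Multiplying \<open>T_op 2 u z\<close> by \<open>(1 - |z|\<^sup>2)\<^sup>3\<close> clears all the weights. The mixed second derivatives \<open>b\<close> and \<open>c\<close>
  enter through their average, one from each of the two operators.
\<close>
lemma T_op_2_wirtinger:
  assumes z: "z \<in> ball 0 1"
    and u: "\<And>w. w \<in> ball 0 1 \<Longrightarrow> wirtinger u (p w) (q w) w"
    and p: "wirtinger p a b z" and q: "wirtinger q c d z"
  shows "T_op 2 u z = 0 \<longleftrightarrow> (1 - z * cnj z) * (b + c) / 2 + z * p z + cnj z * q z = u z"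
proof -
  define N where "N = 1 - (norm z)\<^sup>2"
  have N: "N > 0" unfolding N_def using z by (simp add: power_less_one_iff abs_square_less_1)
  have nz: "norm z < 1" using z by simp
  have N': "1 - z * cnj z = of_real N" unfolding N_def by (simp add: complex_norm_square[symmetric])
  define g where "g = (\<lambda>w::complex. complex_of_real ((1 - (norm w)\<^sup>2) powr (-2)))"
  have g: "wirtinger g (2 * cnj z / of_real N ^ 3) (2 * z / of_real N ^ 3) z"
    unfolding g_def N_def using wirtinger_weight[OF nz] by simp
  have gz: "g z = 1 / of_real N ^ 2" unfolding g_def N_def[symmetric] using N
    by (simp add: powr_minus divide_simps)
  have "wirtinger (\<lambda>w. g w * d_z u w) (g z * a + 2 * cnj z / of_real N ^ 3 * p z)
     (g z * b + 2 * z / of_real N ^ 3 * p z) z"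
    by (rule wirtinger_cong[OF wirtinger_mult[OF g p] open_ball z])
      (simp add: wirtinger_partials(5)[OF u])
  hence L: "L_op 2 u z = g z * b + 2 * z / of_real N ^ 3 * p z"
    unfolding L_op_def g_def by (rule wirtinger_partials(6))
  have "wirtinger (\<lambda>w. g w * d_zbar u w) (g z * c + 2 * cnj z / of_real N ^ 3 * q z)
     (g z * d + 2 * z / of_real N ^ 3 * q z) z"
    by (rule wirtinger_cong[OF wirtinger_mult[OF g q] open_ball z])
      (simp add: wirtinger_partials(6)[OF u])
  hence L': "Lbar_op 2 u z = g z * c + 2 * cnj z / of_real N ^ 3 * q z"
    unfolding Lbar_op_def g_def by (rule wirtinger_partials(5))
  have pw: "complex_of_real (N powr (-3)) = 1 / of_real N ^ 3" using N by (simp add: powr_minus divide_simps)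
  have "T_op 2 u z = ((1 - z * cnj z) * (b + c) / 2 + z * p z + cnj z * q z - u z) / of_real N ^ 3"
    unfolding T_op_def L L' gz N' N_def[symmetric] using N
    by (simp add: pw field_simps power2_eq_square power3_eq_cube)
  thus ?thesis using N by (simp add: algebra_simps)
qed

lemma continuous_on_wirtinger:
  assumes "\<And>z. z \<in> S \<Longrightarrow> wirtinger u (p z) (q z) z"
  shows "continuous_on S u"
  using assms wirtinger_partials(1) differentiable_imp_continuous_within
  by (meson continuous_at_imp_continuous_on)

lemma C1_classI:
  assumes "open S" and pq: "continuous_on S p" "continuous_on S q"
    and u: "\<And>z. z \<in> S \<Longrightarrow> wirtinger u (p z) (q z) z"
  shows "C1_class S u"
proof -
  have "continuous_on S (\<lambda>z. p z + q z)" "continuous_on S (\<lambda>z. \<i> * (p z - q z))"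
    using pq by (auto intro!: continuous_intros)
  from continuous_on_eq[OF this(1), of "partial_x u"] continuous_on_eq[OF this(2), of "partial_y u"]
  show "C1_class S u"
    unfolding C1_class_def using wirtinger_partials(1,3,4)[OF u] by simp
qed

lemma C1_classD:
  assumes "C1_class S u"
  shows "continuous_on S (d_z u)" "continuous_on S (d_zbar u)"
    "z \<in> S \<Longrightarrow> wirtinger u (d_z u z) (d_zbar u z) z"
  using assms differentiable_wirtinger
  unfolding C1_class_def d_z_def[abs_def] d_zbar_def[abs_def]
  by (auto intro!: continuous_intros)

lemma C1_class_linear:
  assumes "open S" "C1_class S u" "C1_class S v"
  shows "C1_class S (\<lambda>z. k * u z + l * v z)"
proof (rule C1_classI[OF assms(1)])
  show "wirtinger (\<lambda>z. k * u z + l * v z) (k * d_z u z + l * d_z v z) (k * d_zbar u z + l * d_zbar v z) z"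
    if "z \<in> S" for z
    by (intro wirtinger_add wirtinger_cmult C1_classD(3)[OF assms(2) that] C1_classD(3)[OF assms(3) that])
qed (intro continuous_on_add continuous_on_mult_left C1_classD[OF assms(2)] C1_classD[OF assms(3)])+

lemma C1_class_cong:
  assumes "open S" "C1_class S u" "\<And>z. z \<in> S \<Longrightarrow> v z = u z"
  shows "C1_class S v"
  by (rule C1_classI[OF assms(1) C1_classD(1,2)[OF assms(2)] wirtinger_cong[OF C1_classD(3)[OF assms(2)] assms(1)]])
    (use assms(3) in auto)

lemma T_harmonic_2D:
  assumes "T_harmonic 2 u"
  shows "C1_class (ball 0 1) (d_z u)" "C1_class (ball 0 1) (d_zbar u)"
    "z \<in> ball 0 1 \<Longrightarrow> wirtinger u (d_z u z) (d_zbar u z) z"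
    "z \<in> ball 0 1 \<Longrightarrow> (1 - z * cnj z) * (d_zbar (d_z u) z + d_z (d_zbar u) z) / 2
       + z * d_z u z + cnj z * d_zbar u z = u z"
proof -
  have C: "C1_class (ball 0 1) u" "C1_class (ball 0 1) (partial_x u)" "C1_class (ball 0 1) (partial_y u)"
    and T: "\<And>z. z \<in> ball 0 1 \<Longrightarrow> T_op 2 u z = 0"
    using assms unfolding T_harmonic_def C2_class_def by auto
  show 1: "C1_class (ball 0 1) (d_z u)"
    using C1_class_linear[OF open_ball C(2,3), of "1/2" "-\<i>/2"]
    unfolding d_z_def[abs_def] by (simp add: diff_divide_distrib)
  show 2: "C1_class (ball 0 1) (d_zbar u)"
    using C1_class_linear[OF open_ball C(2,3), of "1/2" "\<i>/2"]
    unfolding d_zbar_def[abs_def] by (simp add: add_divide_distrib)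
  show 3: "wirtinger u (d_z u z) (d_zbar u z) z" if "z \<in> ball 0 1" for z
    using C1_classD(3)[OF C(1) that] .
  show "(1 - z * cnj z) * (d_zbar (d_z u) z + d_z (d_zbar u) z) / 2
       + z * d_z u z + cnj z * d_zbar u z = u z" if "z \<in> ball 0 1"
    using T_op_2_wirtinger[OF that 3 C1_classD(3)[OF 1 that] C1_classD(3)[OF 2 that]] T[OF that]
    by simp
qed

lemma T_harmonic_2I:
  assumes co: "continuous_on (ball 0 1) a" "continuous_on (ball 0 1) b" "continuous_on (ball 0 1) c" "continuous_on (ball 0 1) d"
    and w: "\<And>z. z \<in> ball 0 1 \<Longrightarrow> wirtinger u (p z) (q z) z"
      "\<And>z. z \<in> ball 0 1 \<Longrightarrow> wirtinger p (a z) (b z) z"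
      "\<And>z. z \<in> ball 0 1 \<Longrightarrow> wirtinger q (c z) (d z) z"
    and eq: "\<And>z. z \<in> ball 0 1 \<Longrightarrow> (1 - z * cnj z) * (b z + c z) / 2 + z * p z + cnj z * q z = u z"
  shows "T_harmonic 2 u"
proof -
  have p: "C1_class (ball 0 1) p" by (rule C1_classI[OF open_ball co(1,2) w(2)])
  have q: "C1_class (ball 0 1) q" by (rule C1_classI[OF open_ball co(3,4) w(3)])
  have "C1_class (ball 0 1) u"
    by (rule C1_classI[OF open_ball continuous_on_wirtinger[OF w(2)] continuous_on_wirtinger[OF w(3)] w(1)])
  moreover have "C1_class (ball 0 1) (partial_x u)"
    by (rule C1_class_cong[OF open_ball C1_class_linear[OF open_ball p q, of 1 1]])
      (simp add: wirtinger_partials(3)[OF w(1)])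
  moreover have "C1_class (ball 0 1) (partial_y u)"
    by (rule C1_class_cong[OF open_ball C1_class_linear[OF open_ball p q, of \<i> "-\<i>"]])
      (simp add: wirtinger_partials(4)[OF w(1)] algebra_simps)
  moreover have "T_op 2 u z = 0" if "z \<in> ball 0 1" for z
    using T_op_2_wirtinger[OF that w(1) w(2)[OF that] w(3)[OF that]] eq[OF that] by simp
  ultimately show "T_harmonic 2 u"
    unfolding T_harmonic_def C2_class_def by simp
qed

lemma T_harmonic_2_linear:
  assumes u: "T_harmonic 2 u" and v: "T_harmonic 2 v"
  shows "T_harmonic 2 (\<lambda>z. k * u z + l * v z)"
proof -
  note u1 = T_harmonic_2D(1)[OF u] and u2 = T_harmonic_2D(2)[OF u]
  note v1 = T_harmonic_2D(1)[OF v] and v2 = T_harmonic_2D(2)[OF v]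
  note co = continuous_on_add[OF continuous_on_mult_left continuous_on_mult_left]
  note wi = wirtinger_add[OF wirtinger_cmult wirtinger_cmult]
  show ?thesis
  proof (rule T_harmonic_2I[OF co[OF C1_classD(1)[OF u1] C1_classD(1)[OF v1]]
        co[OF C1_classD(2)[OF u1] C1_classD(2)[OF v1]]
        co[OF C1_classD(1)[OF u2] C1_classD(1)[OF v2]] co[OF C1_classD(2)[OF u2] C1_classD(2)[OF v2]]
        wi[OF T_harmonic_2D(3)[OF u] T_harmonic_2D(3)[OF v]]
        wi[OF C1_classD(3)[OF u1] C1_classD(3)[OF v1]] wi[OF C1_classD(3)[OF u2] C1_classD(3)[OF v2]]])
    fix z :: complex assume z: "z \<in> ball 0 1"
    let ?N = "1 - z * cnj z"
    have "?N * (k * d_zbar (d_z u) z + l * d_zbar (d_z v) z + (k * d_z (d_zbar u) z + l * d_z (d_zbar v) z)) / 2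
        + z * (k * d_z u z + l * d_z v z) + cnj z * (k * d_zbar u z + l * d_zbar v z)
      = k * (?N * (d_zbar (d_z u) z + d_z (d_zbar u) z) / 2 + z * d_z u z + cnj z * d_zbar u z)
        + l * (?N * (d_zbar (d_z v) z + d_z (d_zbar v) z) / 2 + z * d_z v z + cnj z * d_zbar v z)"
      by (simp add: field_simps)
    thus "?N * (k * d_zbar (d_z u) z + l * d_zbar (d_z v) z + (k * d_z (d_zbar u) z + l * d_z (d_zbar v) z)) / 2
        + z * (k * d_z u z + l * d_z v z) + cnj z * (k * d_zbar u z + l * d_zbar v z) = k * u z + l * v z"
      unfolding T_harmonic_2D(4)[OF u z] T_harmonic_2D(4)[OF v z] .
  qed
qed

text \<open>
  Conjugation interchanges \<open>p\<close> with \<open>q\<close> and \<open>b\<close> with \<open>c\<close>, and so maps the equation to itself.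
\<close>
lemma T_harmonic_2_cnj:
  assumes u: "T_harmonic 2 u"
  shows "T_harmonic 2 (\<lambda>z. cnj (u z))"
proof -
  note u1 = T_harmonic_2D(1)[OF u] and u2 = T_harmonic_2D(2)[OF u]
  show ?thesis
  proof (rule T_harmonic_2I[OF continuous_on_cnj[OF C1_classD(2)[OF u2]] continuous_on_cnj[OF C1_classD(1)[OF u2]]
        continuous_on_cnj[OF C1_classD(2)[OF u1]] continuous_on_cnj[OF C1_classD(1)[OF u1]]
        wirtinger_cnj[OF T_harmonic_2D(3)[OF u]]
        wirtinger_cnj[OF C1_classD(3)[OF u2]] wirtinger_cnj[OF C1_classD(3)[OF u1]]])
    fix z :: complex assume z: "z \<in> ball 0 1"
    have "(1 - z * cnj z) * (cnj (d_z (d_zbar u) z) + cnj (d_zbar (d_z u) z)) / 2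
        + z * cnj (d_zbar u z) + cnj z * cnj (d_z u z)
      = cnj ((1 - z * cnj z) * (d_zbar (d_z u) z + d_z (d_zbar u) z) / 2 + z * d_z u z + cnj z * d_zbar u z)"
      by (simp add: algebra_simps)
    thus "(1 - z * cnj z) * (cnj (d_z (d_zbar u) z) + cnj (d_zbar (d_z u) z)) / 2
        + z * cnj (d_zbar u z) + cnj z * cnj (d_z u z) = cnj (u z)"
      unfolding T_harmonic_2D(4)[OF u z] .
  qed
qed

lemma T_harmonic_2_sum:
  assumes "\<And>k. k \<in> K \<Longrightarrow> T_harmonic 2 (f k)"
  shows "T_harmonic 2 (\<lambda>z. \<Sum>k\<in>K. c k * f k z)"
proof -
  have 0: "T_harmonic 2 (\<lambda>z. 0)"
    by (rule T_harmonic_2I[where p = "\<lambda>_. 0" and q = "\<lambda>_. 0" and a = "\<lambda>_. 0" and b = "\<lambda>_. 0"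
          and c = "\<lambda>_. 0" and d = "\<lambda>_. 0"]) (simp_all add: wirtinger_const)
  from assms show ?thesis
  proof (induction K rule: infinite_finite_induct)
    case (insert k K)
    have "T_harmonic 2 (\<lambda>z. c k * f k z + 1 * (\<Sum>k\<in>K. c k * f k z))"
      by (intro T_harmonic_2_linear insert) (use insert in auto)
    with insert show ?case by simp
  qed (simp_all add: 0)
qed

section \<open>Maximum principle\<close>

lemma second_derivative_test_max:
  fixes g :: "real \<Rightarrow> real"
  assumes "\<delta> > 0" and g: "\<And>t. \<bar>t\<bar> < \<delta> \<Longrightarrow> (g has_real_derivative g' t) (at t)"
    and g': "(g' has_real_derivative s) (at 0)"
    and max: "\<And>t. \<bar>t\<bar> < \<delta> \<Longrightarrow> g t \<le> g 0"
  shows "g' 0 = 0" "s \<le> 0"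
proof -
  show 0: "g' 0 = 0"
    using DERIV_local_max[OF g[of 0] \<open>\<delta> > 0\<close>] max \<open>\<delta> > 0\<close> by simp
  show "s \<le> 0"
  proof (rule ccontr)
    assume "\<not> s \<le> 0"
    then obtain d where d: "d > 0" "\<And>h. h > 0 \<Longrightarrow> h < d \<Longrightarrow> g' 0 < g' (0 + h)"
      using DERIV_pos_inc_right[OF g'] by auto
    define h where "h = min d \<delta> / 2"
    have h: "0 < h" "h < d" "h < \<delta>" unfolding h_def using d \<open>\<delta> > 0\<close> by auto
    obtain x where x: "0 < x" "x < h" "g h - g 0 = (h - 0) * g' x"
      using MVT2[of 0 h g g'] g h by force
    have "g' x > 0" using d(2)[of x] x h 0 by simp
    hence "g h - g 0 > 0" using x h by simp
    thus False using max[of h] h by simp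
  qed
qed

lemma wirtinger_line:
  assumes "wirtinger u p q (z + of_real t * e)"
  shows "((\<lambda>t. Re (c * u (z + of_real t * e))) has_real_derivative Re (c * (p * e + q * cnj e))) (at t)"
proof -
  have 1: "((\<lambda>t. z + of_real t * e) has_derivative (\<lambda>h. of_real h * e)) (at t)"
    by (auto intro!: derivative_eq_intros)
  have "((\<lambda>t. Re (c * u (z + of_real t * e))) has_derivative
     (\<lambda>h. Re (c * (p * (of_real h * e) + q * cnj (of_real h * e))))) (at t)"
    by (intro has_derivative_Re has_derivative_mult_right
        has_derivative_compose[OF 1 assms[unfolded wirtinger_def]])
  thus ?thesis unfolding has_field_derivative_def
    by (elim has_derivative_eq_rhs) (auto simp: fun_eq_iff algebra_simps)
qed

lemma T_harmonic_2_maximum_principle: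
  assumes u: "T_harmonic 2 u" and R: "R < 1"
    and M: "\<And>z. norm z = R \<Longrightarrow> norm (u z) \<le> M" "0 \<le> M" and z: "norm z \<le> R"
  shows "norm (u z) \<le> M"
proof (rule ccontr)
  assume *: "\<not> norm (u z) \<le> M"
  have "continuous_on (ball 0 1) u"
    by (rule continuous_on_wirtinger[OF T_harmonic_2D(3)[OF u]])
  hence "continuous_on (cball 0 R) (\<lambda>z. norm (u z))"
    using R by (intro continuous_on_norm) (auto elim!: continuous_on_subset)
  then obtain w where w: "norm w \<le> R" and wmax: "\<And>y. norm y \<le> R \<Longrightarrow> norm (u y) \<le> norm (u w)"
    using continuous_attains_sup[of "cball 0 R" "\<lambda>z. norm (u z)"] order_trans[OF norm_ge_zero z]
    by auto
  have big: "norm (u w) > M" using wmax[OF z] * by simp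
  hence "norm w \<noteq> R" using M(1)[of w] by auto
  hence wR: "norm w < R" using w by simp
  hence w1: "w \<in> ball 0 1" using R by simp
  \<comment> \<open>Rotates \<open>u w\<close> onto the positive real axis.\<close>
  define c where "c = cnj (u w) / norm (u w)"
  have uw: "norm (u w) > 0" using big M(2) by linarith
  have c: "norm c = 1" "c * u w = norm (u w)"
    unfolding c_def using uw
    by (auto simp: norm_divide complex_norm_square[symmetric] power2_eq_square mult.commute)
  define a b p q where "a = d_z (d_z u) w" and "b = d_zbar (d_z u) w"
    and "p = d_z (d_zbar u) w" and "q = d_zbar (d_zbar u) w"
  define \<delta> where "\<delta> = R - norm w"
  have test: "Re (c * (d_z u w * e + d_zbar u w * cnj e)) = 0"
    "Re (c * ((a * e + b * cnj e) * e + (p * e + q * cnj e) * cnj e)) \<le> 0" if e: "norm e = 1" for e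
  proof -
    let ?l = "\<lambda>t::real. w + of_real t * e"
    have near: "norm (?l t) \<le> R" if "\<bar>t\<bar> < \<delta>" for t
      using norm_triangle_ineq[of w "of_real t * e"] that e unfolding \<delta>_def by (simp add: norm_mult)
    have near1: "?l t \<in> ball 0 1" if "\<bar>t\<bar> < \<delta>" for t
      using near[OF that] R by simp
    have d0: "\<delta> > 0" unfolding \<delta>_def using wR by simp
    have g: "((\<lambda>t. Re (c * u (?l t))) has_real_derivative
        Re (c * (d_z u (?l t) * e + d_zbar u (?l t) * cnj e))) (at t)" if "\<bar>t\<bar> < \<delta>" for t
      by (rule wirtinger_line) (rule T_harmonic_2D(3)[OF u near1[OF that]])
    have w0: "w + complex_of_real 0 * e = w" by simp
    have "((\<lambda>t. Re (c * e * d_z u (?l t))) has_real_derivative Re (c * e * (a * e + b * cnj e))) (at 0)"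
      unfolding a_def b_def
      by (rule wirtinger_line) (unfold w0, rule C1_classD(3)[OF T_harmonic_2D(1)[OF u] w1])
    moreover have "((\<lambda>t. Re (c * cnj e * d_zbar u (?l t))) has_real_derivative
        Re (c * cnj e * (p * e + q * cnj e))) (at 0)"
      unfolding p_def q_def
      by (rule wirtinger_line) (unfold w0, rule C1_classD(3)[OF T_harmonic_2D(2)[OF u] w1])
    ultimately have "((\<lambda>t. Re (c * e * d_z u (?l t)) + Re (c * cnj e * d_zbar u (?l t))) has_real_derivative
        Re (c * e * (a * e + b * cnj e)) + Re (c * cnj e * (p * e + q * cnj e))) (at 0)"
      by (rule DERIV_add)
    hence g': "((\<lambda>t. Re (c * (d_z u (?l t) * e + d_zbar u (?l t) * cnj e))) has_real_derivative
        Re (c * ((a * e + b * cnj e) * e + (p * e + q * cnj e) * cnj e))) (at 0)"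
      unfolding plus_complex.sel(1)[symmetric] by (simp only: ring_distribs mult_ac)
    have mx: "Re (c * u (?l t)) \<le> Re (c * u (?l 0))" if "\<bar>t\<bar> < \<delta>" for t
    proof -
      have "Re (c * u (?l t)) \<le> norm (c * u (?l t))" by (rule complex_Re_le_cmod)
      also have "\<dots> \<le> norm (u w)" using wmax[OF near[OF that]] c by (simp add: norm_mult)
      finally show ?thesis using c by simp
    qed
    show "Re (c * (d_z u w * e + d_zbar u w * cnj e)) = 0"
      using second_derivative_test_max(1)[OF d0 g g' mx] by simp
    show "Re (c * ((a * e + b * cnj e) * e + (p * e + q * cnj e) * cnj e)) \<le> 0"
      using second_derivative_test_max(2)[OF d0 g g' mx] by simp
  qed
  \<comment> \<open>Adding the tests in the directions \<open>1\<close> and \<open>\<i>\<close> cancels \<open>a\<close> and \<open>q\<close> and leaves the Laplacian.\<close>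
  have "Re (c * (b + p)) \<le> 0"
    using test(2)[of 1] test(2)[of \<i>] by (simp add: algebra_simps)
  moreover have N: "1 - (norm w)\<^sup>2 > 0" using w1 by (simp add: power_less_one_iff abs_square_less_1)
  ultimately have "(1 - (norm w)\<^sup>2) * Re (c * (b + p)) / 2 \<le> 0"
    by (simp add: mult_le_0_iff)
  moreover have "Re (c * u w) = (1 - (norm w)\<^sup>2) * Re (c * (b + p)) / 2
     + Re w * Re (c * (d_z u w * 1 + d_zbar u w * cnj 1)) + Im w * Re (c * (d_z u w * \<i> + d_zbar u w * cnj \<i>))"
  proof -
    have "u w = of_real (1 - (norm w)\<^sup>2) * (b + p) / 2 + w * d_z u w + cnj w * d_zbar u w"
      using T_harmonic_2D(4)[OF u w1] unfolding b_def p_def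
      by (simp add: complex_norm_square[symmetric])
    hence "c * u w = of_real (1 - (norm w)\<^sup>2) * (c * (b + p)) / 2 + c * (w * d_z u w + cnj w * d_zbar u w)"
      by (simp only: ring_distribs mult_ac times_divide_eq_right add_ac)
    hence "Re (c * u w) = (1 - (norm w)\<^sup>2) * Re (c * (b + p)) / 2 + Re (c * (w * d_z u w + cnj w * d_zbar u w))"
      by (simp add: Re_divide_numeral del: of_real_diff of_real_power)
    also have "Re (c * (w * d_z u w + cnj w * d_zbar u w)) =
       Re w * Re (c * (d_z u w * 1 + d_zbar u w * cnj 1)) + Im w * Re (c * (d_z u w * \<i> + d_zbar u w * cnj \<i>))"
      by (simp add: algebra_simps)
    finally show ?thesis by simp
  qed
  moreover have "Re (c * (d_z u w * 1 + d_zbar u w * cnj 1)) = 0"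
    "Re (c * (d_z u w * \<i> + d_zbar u w * cnj \<i>)) = 0" by (rule test(1), simp)+
  moreover have "Re (c * u w) > 0" using uw unfolding c(2) by simp
  ultimately show False by simp
qed

section \<open>Separated solutions\<close>

text \<open>
  The solutions whose restriction to each circle about \<open>0\<close> is a multiple of the \<open>k\<close>-th character, scaled to
  equal \<open>\<zeta> powi k\<close> on the unit circle: separation of variables for the operator.
\<close>
definition T2_mode :: "int \<Rightarrow> complex \<Rightarrow> complex" where
  "T2_mode k z = (if k \<ge> 0 then z else cnj z) ^ nat \<bar>k\<bar> *
     (of_int (\<bar>k\<bar> + 1) - of_int (\<bar>k\<bar> - 1) * (z * cnj z)) / 2"

lemma T2_mode_uminus: "T2_mode (- k) z = cnj (T2_mode k z)"
  unfolding T2_mode_def by (cases "k = 0") (auto simp: mult.commute)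

lemma T2_mode_of_nat:
  "T2_mode (int n) z = ((of_nat n + 1) * z ^ n - (of_nat n - 1) * z ^ (n + 1) * cnj z) / 2"
  unfolding T2_mode_def by (simp add: algebra_simps)

text \<open>
  On a circle about \<open>0\<close> inside the unit disk a mode is a positive multiple of a character. Hence a finite Laurent sum on that
  circle extends to a solution by dividing each coefficient by its factor.
\<close>
lemma T2_mode_on_circle:
  assumes "norm \<zeta> = 1"
  shows "T2_mode k (of_real R * \<zeta>) =
     of_real (R ^ nat \<bar>k\<bar> * (\<bar>k\<bar> + 1 - (\<bar>k\<bar> - 1) * R\<^sup>2) / 2) * \<zeta> powi k"
proof -
  have z: "\<zeta> * cnj \<zeta> = 1" "\<zeta> \<noteq> 0" using assms by (auto simp: complex_norm_square[symmetric])
  hence "cnj \<zeta> = inverse \<zeta>" by (simp add: field_simps)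
  moreover have "of_real R * \<zeta> * cnj (of_real R * \<zeta>) = of_real (R\<^sup>2)"
    using z by (simp add: power2_eq_square algebra_simps)
  ultimately show ?thesis unfolding T2_mode_def power_int_def
    by (simp add: power_mult_distrib power_inverse)
qed

lemma T_harmonic_T2_mode: "T_harmonic 2 (T2_mode k)"
proof -
  have nat: "T_harmonic 2 (\<lambda>z. T2_mode (int n) z)" for n
    unfolding T2_mode_of_nat
  proof (rule T_harmonic_2I)
    define m where "m = (of_nat n :: complex)"
    let ?p = "\<lambda>z. ((m + 1) * (m * z ^ (n - 1)) - (m - 1) * ((m + 1) * z ^ n) * cnj z) / 2"
    let ?q = "\<lambda>z. - (m - 1) * z ^ (n + 1) / 2"
    let ?a = "\<lambda>z. ((m + 1) * (m * (of_nat (n - 1) * z ^ (n - 1 - 1))) - (m - 1) * ((m + 1) * (m * z ^ (n - 1))) * cnj z) / 2"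
    let ?b = "\<lambda>z. - (m - 1) * (m + 1) * z ^ n / 2"
    show "continuous_on (ball 0 1) ?a" "continuous_on (ball 0 1) ?b" "continuous_on (ball 0 1) ?b"
      "continuous_on (ball 0 1) (\<lambda>_. 0::complex)"
      by (intro continuous_intros; simp)+
    fix z :: complex
    show "wirtinger (\<lambda>z. ((of_nat n + 1) * z ^ n - (of_nat n - 1) * z ^ (n + 1) * cnj z) / 2) (?p z) (?q z) z"
      unfolding wirtinger_def m_def
      by (auto intro!: derivative_eq_intros simp: fun_eq_iff field_simps simp del: power_Suc)
    show "wirtinger ?p (?a z) (?b z) z"
      unfolding wirtinger_def
      by (auto intro!: derivative_eq_intros simp: fun_eq_iff m_def field_simps)
    show "wirtinger ?q (?b z) 0 z"
      unfolding wirtinger_def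
      by (auto intro!: derivative_eq_intros simp: fun_eq_iff m_def field_simps simp del: power_Suc)
    have zp: "z * ?p z = ((m + 1) * (m * z ^ n) - (m - 1) * ((m + 1) * z ^ n) * (z * cnj z)) / 2"
      unfolding m_def by (cases n) (auto simp: algebra_simps)
    show "(1 - z * cnj z) * (?b z + ?b z) / 2 + z * ?p z + cnj z * ?q z =
       ((of_nat n + 1) * z ^ n - (of_nat n - 1) * z ^ (n + 1) * cnj z) / 2"
      unfolding m_def[symmetric] zp by (simp add: field_simps)
  qed
  show ?thesis
  proof (cases "k \<ge> 0")
    case True
    thus ?thesis using nat[of "nat k"] by simp
  next
    case False
    have "T2_mode k = (\<lambda>z. cnj (T2_mode (int (nat (- k))) z))"
      using T2_mode_uminus[of "- k"] False by auto
    thus ?thesis using T_harmonic_2_cnj[OF nat[of "nat (- k)"]] by metis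
  qed
qed

section \<open>Means over the unit circle\<close>

text \<open>
  Averages are taken along \<open>circlepath 0 1\<close> on \<open>{0..1}\<close>, so that they have total mass 1 and are contour
  integrals up to the factor \<open>2 \<pi> \<i> \<zeta>\<close>.
\<close>
definition circle_mean :: "(complex \<Rightarrow> 'a::euclidean_space) \<Rightarrow> 'a" where
  "circle_mean f = integral {0..1} (\<lambda>t. f (circlepath 0 1 t))"

lemma circlepath_in_sphere: "circlepath 0 1 t \<in> sphere 0 1"
  by (simp add: circlepath norm_exp_eq_Re)

lemma integrable_circle:
  fixes f :: "complex \<Rightarrow> 'a::euclidean_space"
  assumes "continuous_on (sphere 0 1) f"
  shows "(\<lambda>t. f (circlepath 0 1 t)) integrable_on {0..1}"
proof (rule integrable_continuous_real)
  have "continuous_on {0..1} (circlepath 0 1)"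
    using path_circlepath unfolding path_def by blast
  thus "continuous_on {0..1} (\<lambda>t. f (circlepath 0 1 t))"
    by (intro continuous_on_compose2[OF assms]) (auto simp: circlepath_in_sphere[simplified])
qed

lemma circle_mean_cong:
  assumes "\<And>\<zeta>. norm \<zeta> = 1 \<Longrightarrow> f \<zeta> = g \<zeta>"
  shows "circle_mean f = circle_mean g"
  unfolding circle_mean_def using circlepath_in_sphere assms by (simp add: dist_norm)

lemma circle_mean_const: "circle_mean (\<lambda>\<zeta>. c) = c"
  unfolding circle_mean_def by simp

lemma circle_mean_linear:
  assumes "bounded_linear h" "continuous_on (sphere 0 1) f"
  shows "circle_mean (\<lambda>\<zeta>. h (f \<zeta>)) = h (circle_mean f)"
  unfolding circle_mean_def
  using integral_linear[OF integrable_circle[OF assms(2)] assms(1)] by (simp add: o_def)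

lemma circle_mean_sum:
  assumes "finite K" "\<And>k. k \<in> K \<Longrightarrow> continuous_on (sphere 0 1) (f k)"
  shows "circle_mean (\<lambda>\<zeta>. \<Sum>k\<in>K. f k \<zeta>) = (\<Sum>k\<in>K. circle_mean (f k))"
  unfolding circle_mean_def by (intro integral_sum assms integrable_circle)

lemma circle_mean_add:
  assumes "continuous_on (sphere 0 1) f" "continuous_on (sphere 0 1) g"
  shows "circle_mean (\<lambda>\<zeta>. f \<zeta> + g \<zeta>) = circle_mean f + circle_mean g"
  unfolding circle_mean_def by (intro integral_add integrable_circle assms)

lemma circle_mean_diff:
  assumes "continuous_on (sphere 0 1) f" "continuous_on (sphere 0 1) g"
  shows "circle_mean (\<lambda>\<zeta>. f \<zeta> - g \<zeta>) = circle_mean f - circle_mean g"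
  unfolding circle_mean_def by (intro integral_diff integrable_circle assms)

lemma norm_circle_mean_le:
  assumes "continuous_on (sphere 0 1) f" "continuous_on (sphere 0 1) g"
    "\<And>\<zeta>. norm \<zeta> = 1 \<Longrightarrow> norm (f \<zeta>) \<le> g \<zeta>"
  shows "norm (circle_mean f) \<le> circle_mean g"
  unfolding circle_mean_def using circlepath_in_sphere assms(3)
  by (intro integral_norm_bound_integral integrable_circle assms(1,2)) simp

lemma circle_mean_mono:
  fixes f g :: "complex \<Rightarrow> real"
  assumes "continuous_on (sphere 0 1) f" "continuous_on (sphere 0 1) g"
    "\<And>\<zeta>. norm \<zeta> = 1 \<Longrightarrow> f \<zeta> \<le> g \<zeta>"
  shows "circle_mean f \<le> circle_mean g"
  unfolding circle_mean_def using circlepath_in_sphere assms(3)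
  by (intro integral_le integrable_circle assms(1,2)) simp

lemma circle_mean_contour_integral:
  "circle_mean f = contour_integral (circlepath 0 1) (\<lambda>\<zeta>. f \<zeta> / \<zeta>) / (2 * of_real pi * \<i>)"
proof -
  have "contour_integral (circlepath 0 1) (\<lambda>\<zeta>. f \<zeta> / \<zeta>)
     = integral {0..1} (\<lambda>t. f (circlepath 0 1 t) * (2 * of_real pi * \<i>))"
    unfolding contour_integral_integral vector_derivative_circlepath
    by (intro integral_cong) (simp add: circlepath field_simps)
  thus ?thesis unfolding circle_mean_def by simp
qed

lemma continuous_on_powi [continuous_intros]:
  "continuous_on (sphere 0 1) (\<lambda>\<zeta>::complex. \<zeta> powi k)"
  by (intro continuous_on_power_int continuous_on_id) auto

lemma circle_mean_power:
  assumes "n > 0"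
  shows "circle_mean (\<lambda>\<zeta>. \<zeta> ^ n) = 0"
proof -
  obtain m where n: "n = Suc m" using assms by (cases n) auto
  have "contour_integral (circlepath 0 1) (\<lambda>\<zeta>. \<zeta> ^ n / \<zeta>) = contour_integral (circlepath 0 1) (\<lambda>\<zeta>. \<zeta> ^ m)"
    using n by (intro contour_integral_cong) (auto simp: path_image_circlepath)
  also have "\<dots> = 0"
    by (rule contour_integral_unique[OF Cauchy_theorem_disc_simple[of _ 0 2]])
      (auto intro!: holomorphic_intros)
  finally show ?thesis unfolding circle_mean_contour_integral by simp
qed

lemma cnj_circle_mean:
  "continuous_on (sphere 0 1) f \<Longrightarrow> circle_mean (\<lambda>\<zeta>. cnj (f \<zeta>)) = cnj (circle_mean f)"
  using circle_mean_linear[OF bounded_linear_cnj] .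

lemma powi_uminus_unit_circle: "norm \<zeta> = 1 \<Longrightarrow> \<zeta> powi (- k) = cnj (\<zeta> powi k)"
proof -
  assume "norm \<zeta> = 1"
  hence "\<zeta> * cnj \<zeta> = 1" by (simp add: complex_norm_square[symmetric])
  hence "cnj \<zeta> = inverse \<zeta>" using inverse_unique by metis
  thus ?thesis by (simp add: power_int_minus power_int_inverse)
qed

lemma circle_mean_powi: "circle_mean (\<lambda>\<zeta>. \<zeta> powi k) = (if k = 0 then 1 else 0)"
proof -
  consider "k = 0" | "k > 0" | "k < 0" by linarith
  thus ?thesis
  proof cases
    case 1 thus ?thesis by (simp add: circle_mean_const)
  next
    case 2 thus ?thesis using circle_mean_power[of "nat k"] by (simp add: power_int_def)
  next
    case 3
    have "circle_mean (\<lambda>\<zeta>. \<zeta> powi k) = circle_mean (\<lambda>\<zeta>. cnj (\<zeta> powi (- k)))"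
      by (intro circle_mean_cong) (use powi_uminus_unit_circle[of _ "- k"] in simp)
    also have "\<dots> = cnj (circle_mean (\<lambda>\<zeta>. \<zeta> powi (- k)))"
      by (intro cnj_circle_mean continuous_intros)
    also have "circle_mean (\<lambda>\<zeta>. \<zeta> powi (- k)) = 0"
      using circle_mean_power[of "nat (- k)"] 3 by (simp add: power_int_def)
    finally show ?thesis using 3 by simp
  qed
qed

section \<open>Trigonometric polynomials\<close>

definition laurent_sum :: "int set \<Rightarrow> (int \<Rightarrow> complex) \<Rightarrow> complex \<Rightarrow> complex" where
  "laurent_sum K c \<zeta> = (\<Sum>k\<in>K. c k * \<zeta> powi k)"

lemma continuous_on_laurent_sum: "continuous_on (sphere 0 1) (laurent_sum K c)"
  unfolding laurent_sum_def[abs_def] by (intro continuous_intros)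

lemma laurent_sum_coeff:
  assumes "finite K"
  shows "circle_mean (\<lambda>\<zeta>. laurent_sum K c \<zeta> * \<zeta> powi (- j)) = (if j \<in> K then c j else 0)"
proof -
  have "circle_mean (\<lambda>\<zeta>. laurent_sum K c \<zeta> * \<zeta> powi (- j)) = circle_mean (\<lambda>\<zeta>. \<Sum>k\<in>K. c k * \<zeta> powi (k - j))"
  proof (rule circle_mean_cong)
    fix \<zeta> :: complex assume "norm \<zeta> = 1"
    hence "\<zeta> \<noteq> 0" by auto
    hence *: "c k * \<zeta> powi k * \<zeta> powi (- j) = c k * \<zeta> powi (k - j)" for k
      using power_int_add[of \<zeta> k "- j"] by simp
    show "laurent_sum K c \<zeta> * \<zeta> powi (- j) = (\<Sum>k\<in>K. c k * \<zeta> powi (k - j))"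
      unfolding laurent_sum_def sum_distrib_right by (intro sum.cong refl *)
  qed
  also have "\<dots> = (\<Sum>k\<in>K. circle_mean (\<lambda>\<zeta>. c k * \<zeta> powi (k - j)))"
    by (intro circle_mean_sum assms continuous_intros)
  also have "\<dots> = (\<Sum>k\<in>K. c k * circle_mean (\<lambda>\<zeta>. \<zeta> powi (k - j)))"
    by (intro sum.cong refl circle_mean_linear bounded_linear_mult_right continuous_intros)
  also have "\<dots> = (\<Sum>k\<in>K. if k = j then c k else 0)"
    by (intro sum.cong) (auto simp: circle_mean_powi)
  also have "\<dots> = (if j \<in> K then c j else 0)" using assms by simp
  finally show ?thesis .
qed

lemma norm_laurent_coeff_le:
  assumes "finite K" "j \<in> K" "\<And>\<zeta>. norm \<zeta> = 1 \<Longrightarrow> norm (laurent_sum K c \<zeta>) \<le> M"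
  shows "norm (c j) \<le> M"
proof -
  have "norm (circle_mean (\<lambda>\<zeta>. laurent_sum K c \<zeta> * \<zeta> powi (- j))) \<le> circle_mean (\<lambda>\<zeta>. M)"
    by (intro norm_circle_mean_le continuous_intros continuous_on_laurent_sum)
      (use assms(3) in \<open>auto simp: norm_mult norm_power_int\<close>)
  thus ?thesis unfolding laurent_sum_coeff[OF assms(1)] using assms(2) by (simp add: circle_mean_const)
qed

text \<open>
  On the unit circle \<open>cnj \<zeta> = 1 / \<zeta>\<close>, so the coordinates, and with them all real polynomials in the
  coordinates, are quotients of a polynomial in \<open>\<zeta>\<close> by a power of \<open>\<zeta>\<close>. The quotient form makes closure
  under products obvious.
\<close>
lemma real_polynomial_on_unit_circle:
  assumes "real_polynomial_function g"
  shows "\<exists>p n. \<forall>\<zeta>::complex. norm \<zeta> = 1 \<longrightarrow> of_real (g \<zeta>) = poly p \<zeta> / \<zeta> ^ n"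
  using assms
proof induction
  case (linear f)
  have "of_real (f \<zeta>) = poly [: (f 1 + \<i> * f \<i>) / 2, 0, (f 1 - \<i> * f \<i>) / 2 :] \<zeta> / \<zeta> ^ 1" if "norm \<zeta> = 1" for \<zeta>
  proof -
    have 1: "\<zeta> * cnj \<zeta> = 1" and 0: "\<zeta> \<noteq> 0" using that by (auto simp: complex_norm_square[symmetric])
    interpret bounded_linear f by fact
    have "\<zeta> = Re \<zeta> *\<^sub>R 1 + Im \<zeta> *\<^sub>R \<i>" by (simp add: complex_eq_iff)
    hence f: "f \<zeta> = Re \<zeta> * f 1 + Im \<zeta> * f \<i>" by (metis add scaleR real_scaleR_def)
    have "\<zeta> * of_real (f \<zeta>) = (f 1 + \<i> * f \<i>) / 2 * (\<zeta> * cnj \<zeta>) + (f 1 - \<i> * f \<i>) / 2 * \<zeta> ^ 2"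
      unfolding f by (simp add: complex_eq_iff algebra_simps power2_eq_square add_divide_distrib diff_divide_distrib)
    thus ?thesis using 0 unfolding 1 by (simp add: field_simps power2_eq_square)
  qed
  thus ?case by blast
next
  case (const c)
  have "of_real c = poly [: of_real c :] \<zeta> / \<zeta> ^ 0" for \<zeta> :: complex by simp
  thus ?case by blast
next
  case (add f g)
  then obtain p n q m where f: "\<And>\<zeta>::complex. norm \<zeta> = 1 \<Longrightarrow> of_real (f \<zeta>) = poly p \<zeta> / \<zeta> ^ n"
    and g: "\<And>\<zeta>::complex. norm \<zeta> = 1 \<Longrightarrow> of_real (g \<zeta>) = poly q \<zeta> / \<zeta> ^ m" by blast
  have "of_real (f \<zeta> + g \<zeta>) = poly (p * monom 1 m + q * monom 1 n) \<zeta> / \<zeta> ^ (n + m)" if "norm \<zeta> = 1" for \<zeta>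
  proof -
    have "\<zeta> \<noteq> 0" using that by auto
    thus ?thesis unfolding of_real_add f[OF that] g[OF that]
      by (simp add: poly_monom field_simps power_add)
  qed
  thus ?case by blast
next
  case (mult f g)
  then obtain p n q m where f: "\<And>\<zeta>::complex. norm \<zeta> = 1 \<Longrightarrow> of_real (f \<zeta>) = poly p \<zeta> / \<zeta> ^ n"
    and g: "\<And>\<zeta>::complex. norm \<zeta> = 1 \<Longrightarrow> of_real (g \<zeta>) = poly q \<zeta> / \<zeta> ^ m" by blast
  have "of_real (f \<zeta> * g \<zeta>) = poly (p * q) \<zeta> / \<zeta> ^ (n + m)" if "norm \<zeta> = 1" for \<zeta>
    unfolding of_real_mult f[OF that] g[OF that] by (simp add: power_add)
  thus ?case by blast
qed

lemma laurent_sum_of_poly: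
  assumes "\<zeta> \<noteq> 0"
  shows "poly p \<zeta> / \<zeta> ^ n = laurent_sum {- int n..int (degree p) - int n} (\<lambda>k. coeff p (nat (k + int n))) \<zeta>"
proof -
  have "poly p \<zeta> / \<zeta> ^ n = (\<Sum>i\<le>degree p. coeff p i * \<zeta> powi (int i - int n))"
    unfolding poly_altdef sum_divide_distrib using assms by (simp add: power_int_diff)
  also have "\<dots> = laurent_sum {- int n..int (degree p) - int n} (\<lambda>k. coeff p (nat (k + int n))) \<zeta>"
    unfolding laurent_sum_def
    by (rule sum.reindex_bij_witness[of _ "\<lambda>k. nat (k + int n)" "\<lambda>i. int i - int n"]) auto
  finally show ?thesis .
qed

text \<open>
  The Weierstrass theorem for trigonometric polynomials, deduced from the one for polynomials in two
  real variables.
\<close>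
lemma laurent_sum_approximation:
  assumes "continuous_on (sphere 0 1) f" "e > 0"
  obtains K c where "finite K" "\<And>\<zeta>. norm \<zeta> = 1 \<Longrightarrow> norm (f \<zeta> - laurent_sum K c \<zeta>) < e"
proof -
  obtain g where g: "polynomial_function g" "\<And>\<zeta>. \<zeta> \<in> sphere 0 1 \<Longrightarrow> norm (f \<zeta> - g \<zeta>) < e"
    using Stone_Weierstrass_polynomial_function[OF compact_sphere assms] by blast
  have "real_polynomial_function (\<lambda>z. Re (g z))" "real_polynomial_function (\<lambda>z. Im (g z))"
    using g(1) bounded_linear_Re bounded_linear_Im unfolding polynomial_function_def o_def by blast+
  then obtain p n q m where
    p: "\<And>\<zeta>::complex. norm \<zeta> = 1 \<Longrightarrow> of_real (Re (g \<zeta>)) = poly p \<zeta> / \<zeta> ^ n" and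
    q: "\<And>\<zeta>::complex. norm \<zeta> = 1 \<Longrightarrow> of_real (Im (g \<zeta>)) = poly q \<zeta> / \<zeta> ^ m"
    using real_polynomial_on_unit_circle by metis
  have "g \<zeta> = poly (p * monom 1 m + smult \<i> (q * monom 1 n)) \<zeta> / \<zeta> ^ (n + m)" if "norm \<zeta> = 1" for \<zeta>
  proof -
    have "\<zeta> \<noteq> 0" using that by auto
    moreover have "g \<zeta> = poly p \<zeta> / \<zeta> ^ n + \<i> * (poly q \<zeta> / \<zeta> ^ m)"
      unfolding p[OF that, symmetric] q[OF that, symmetric] by (rule complex_eq)
    ultimately show ?thesis by (simp add: poly_monom field_simps power_add)
  qed
  hence "\<exists>p n. \<forall>\<zeta>. norm \<zeta> = 1 \<longrightarrow> g \<zeta> = poly p \<zeta> / \<zeta> ^ n" by blast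
  then obtain p n where p: "\<And>\<zeta>. norm \<zeta> = 1 \<Longrightarrow> g \<zeta> = poly p \<zeta> / \<zeta> ^ n" by blast
  have "norm (f \<zeta> - laurent_sum {- int n..int (degree p) - int n} (\<lambda>k. coeff p (nat (k + int n))) \<zeta>) < e"
    if "norm \<zeta> = 1" for \<zeta>
  proof -
    have "\<zeta> \<noteq> 0" using that by auto
    thus ?thesis using g(2)[of \<zeta>] p[OF that] laurent_sum_of_poly[of \<zeta> p n] that by simp
  qed
  from that[OF _ this] show ?thesis by simp
qed

section \<open>Poisson kernel\<close>

text \<open>
  The Poisson kernel of \<open>T\<^sub>\<alpha>\<close> for \<open>\<alpha> = 2\<close>, with \<open>\<zeta>\<close> on the unit circle.
\<close>
definition T2_poisson :: "complex \<Rightarrow> complex \<Rightarrow> real" where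
  "T2_poisson z \<zeta> = (1 - (norm z)\<^sup>2) ^ 3 / (2 * norm (\<zeta> - z) ^ 4)"

lemma continuous_on_T2_poisson: "norm z < 1 \<Longrightarrow> continuous_on (sphere 0 1) (T2_poisson z)"
  unfolding T2_poisson_def[abs_def] by (intro continuous_intros) auto

text \<open>
  On the unit circle \<open>|\<zeta> - z|\<^sup>2 = (\<zeta> - z) (1 - cnj z \<zeta>) / \<zeta>\<close>, so the mean is a contour integral with a double
  pole at \<open>z\<close>. Cauchy's formula for the first derivative evaluates it.
\<close>
lemma circle_mean_poisson_power:
  assumes z: "norm z < 1"
  shows "circle_mean (\<lambda>\<zeta>. of_real (T2_poisson z \<zeta>) * \<zeta> ^ n) = T2_mode (int n) z"
proof -
  define N where "N = 1 - z * cnj z"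
  have N: "complex_of_real (1 - (norm z)\<^sup>2) = N" unfolding N_def by (simp add: complex_norm_square[symmetric])
  have "1 - (norm z)\<^sup>2 > 0" using z by (simp add: power_less_one_iff abs_square_less_1)
  hence N0: "N \<noteq> 0" unfolding N[symmetric] by (metis less_irrefl of_real_eq_0_iff)
  \<comment> \<open>The integrand without its double pole and a constant factor; it is holomorphic because \<open>cnj z\<close> is constant.\<close>
  define f where "f = (\<lambda>\<zeta>. \<zeta> ^ (n + 1) / (1 - cnj z * \<zeta>)\<^sup>2)"
  have ne: "1 - cnj z * \<zeta> \<noteq> 0" if "norm \<zeta> \<le> 1" for \<zeta>
  proof
    assume "1 - cnj z * \<zeta> = 0"
    hence "norm (cnj z * \<zeta>) = 1" by (metis eq_iff_diff_eq_0 norm_one)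
    moreover have "norm (cnj z * \<zeta>) \<le> norm z * 1"
      unfolding norm_mult complex_mod_cnj using that by (intro mult_left_mono) auto
    ultimately show False using z by simp
  qed
  have hol: "f holomorphic_on ball 0 1" unfolding f_def
    by (intro holomorphic_intros) (use ne in auto)
  have con: "continuous_on (cball 0 1) f" unfolding f_def
    by (intro continuous_intros) (use ne in auto)
  have der: "(f has_field_derivative
      ((of_nat (n + 1) * z ^ n) * N\<^sup>2 + z ^ (n + 1) * (2 * N * cnj z)) / (N\<^sup>2 * N\<^sup>2)) (at z)"
    unfolding f_def N_def using ne[of z] z
    by (auto intro!: derivative_eq_intros simp: algebra_simps simp del: power_Suc)
  have "circle_mean (\<lambda>\<zeta>. of_real (T2_poisson z \<zeta>) * \<zeta> ^ n)
      = contour_integral (circlepath 0 1) (\<lambda>\<zeta>. N ^ 3 / 2 * (f \<zeta> / (\<zeta> - z)\<^sup>2)) / (2 * of_real pi * \<i>)"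
    unfolding circle_mean_contour_integral
  proof (intro arg_cong2[where f = "(/)"] contour_integral_cong refl)
    fix \<zeta> assume "\<zeta> \<in> path_image (circlepath 0 1)"
    hence \<zeta>: "norm \<zeta> = 1" by (auto simp: path_image_circlepath)
    hence 1: "\<zeta> * cnj \<zeta> = 1" and 0: "\<zeta> \<noteq> 0" by (auto simp: complex_norm_square[symmetric])
    have "\<zeta> * of_real (norm (\<zeta> - z) ^ 2) = (\<zeta> - z) * (\<zeta> * cnj \<zeta> - cnj z * \<zeta>)"
      unfolding complex_norm_square by (simp add: algebra_simps)
    hence "(\<zeta> * of_real (norm (\<zeta> - z) ^ 2))\<^sup>2 = (\<zeta> - z)\<^sup>2 * (1 - cnj z * \<zeta>)\<^sup>2"
      unfolding 1 by (simp add: power_mult_distrib)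
    moreover have "(\<zeta> * of_real (norm (\<zeta> - z) ^ 2))\<^sup>2 = \<zeta>\<^sup>2 * of_real (norm (\<zeta> - z) ^ 4)"
      by (simp add: power_mult_distrib)
    ultimately have "complex_of_real (norm (\<zeta> - z) ^ 4) = (\<zeta> - z)\<^sup>2 * (1 - cnj z * \<zeta>)\<^sup>2 / \<zeta>\<^sup>2"
      using 0 by (simp add: field_simps)
    moreover have "complex_of_real (T2_poisson z \<zeta>) = N ^ 3 / (2 * of_real (norm (\<zeta> - z) ^ 4))"
      unfolding T2_poisson_def N[symmetric] by simp
    ultimately show "of_real (T2_poisson z \<zeta>) * \<zeta> ^ n / \<zeta> = N ^ 3 / 2 * (f \<zeta> / (\<zeta> - z)\<^sup>2)"
      unfolding f_def using 0 by (simp add: power2_eq_square)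
  qed
  also have "\<dots> = N ^ 3 / 2 * deriv f z"
    using Cauchy_contour_integral_circlepath_2[OF con hol, of z] z
      Cauchy_derivative_integral_circlepath(1)[OF con hol, of z]
    by (subst contour_integral_lmul) (auto simp: mult.left_commute[of "N ^ 3" \<i>])
  also have "\<dots> = T2_mode (int n) z"
  proof -
    have "N ^ 3 / 2 * deriv f z = ((of_nat n + 1) * z ^ n * N + z ^ (n + 1) * (2 * cnj z)) / 2"
      unfolding DERIV_imp_deriv[OF der] using N0 by (simp add: field_simps power2_eq_square power3_eq_cube)
    thus ?thesis unfolding T2_mode_of_nat N_def by (simp add: algebra_simps)
  qed
  finally show ?thesis .
qed

text \<open>
  The kernel is real, so conjugation reduces negative exponents to the previous lemma.
\<close>
lemma circle_mean_poisson_powi: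
  assumes z: "norm z < 1"
  shows "circle_mean (\<lambda>\<zeta>. of_real (T2_poisson z \<zeta>) * \<zeta> powi k) = T2_mode k z"
proof (cases "k \<ge> 0")
  case True
  thus ?thesis using circle_mean_poisson_power[OF z, of "nat k"] by (simp add: power_int_def)
next
  case False
  have "circle_mean (\<lambda>\<zeta>. of_real (T2_poisson z \<zeta>) * \<zeta> powi k)
     = circle_mean (\<lambda>\<zeta>. cnj (of_real (T2_poisson z \<zeta>) * \<zeta> ^ nat (- k)))"
  proof (rule circle_mean_cong)
    fix \<zeta> :: complex assume "norm \<zeta> = 1"
    thus "of_real (T2_poisson z \<zeta>) * \<zeta> powi k = cnj (of_real (T2_poisson z \<zeta>) * \<zeta> ^ nat (- k))"
      using powi_uminus_unit_circle[of \<zeta> "- k"] False by (simp add: power_int_def)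
  qed
  also have "\<dots> = cnj (T2_mode (int (nat (- k))) z)"
    unfolding circle_mean_poisson_power[OF z, symmetric]
    by (intro cnj_circle_mean continuous_intros continuous_on_T2_poisson z)
  also have "\<dots> = T2_mode k z" using False T2_mode_uminus[of "- k" z] by simp
  finally show ?thesis .
qed

lemma circle_mean_poisson_laurent:
  assumes z: "norm z < 1" and K: "finite K"
  shows "circle_mean (\<lambda>\<zeta>. of_real (T2_poisson z \<zeta>) * laurent_sum K c \<zeta>) = (\<Sum>k\<in>K. c k * T2_mode k z)"
proof -
  have "circle_mean (\<lambda>\<zeta>. of_real (T2_poisson z \<zeta>) * laurent_sum K c \<zeta>)
      = circle_mean (\<lambda>\<zeta>. \<Sum>k\<in>K. c k * (of_real (T2_poisson z \<zeta>) * \<zeta> powi k))"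
    unfolding laurent_sum_def sum_distrib_left by (simp add: mult_ac)
  also have "\<dots> = (\<Sum>k\<in>K. circle_mean (\<lambda>\<zeta>. c k * (of_real (T2_poisson z \<zeta>) * \<zeta> powi k)))"
    by (intro circle_mean_sum K continuous_intros continuous_on_T2_poisson z)
  also have "\<dots> = (\<Sum>k\<in>K. c k * circle_mean (\<lambda>\<zeta>. of_real (T2_poisson z \<zeta>) * \<zeta> powi k))"
    by (intro sum.cong refl circle_mean_linear bounded_linear_mult_right continuous_intros continuous_on_T2_poisson z)
  finally show ?thesis unfolding circle_mean_poisson_powi[OF z] .
qed

section \<open>Approximation by Poisson integrals\<close>

lemma sum_nat_abs_le_suminf:
  fixes g :: "nat \<Rightarrow> real"
  assumes "finite K" "summable g" "\<And>n. 0 \<le> g n"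
  shows "(\<Sum>k\<in>K. g (nat \<bar>k\<bar>)) \<le> 2 * suminf g"
proof -
  have half: "(\<Sum>k\<in>A. g (nat \<bar>k\<bar>)) \<le> suminf g" if "finite A" "inj_on (\<lambda>k. nat \<bar>k\<bar>) A" for A :: "int set"
  proof -
    have "(\<Sum>k\<in>A. g (nat \<bar>k\<bar>)) = sum g ((\<lambda>k. nat \<bar>k\<bar>) ` A)"
      using that(2) by (simp add: sum.reindex)
    also have "\<dots> \<le> suminf g" by (intro sum_le_suminf assms) (use that in auto)
    finally show ?thesis .
  qed
  have "(\<Sum>k\<in>K. g (nat \<bar>k\<bar>)) = (\<Sum>k\<in>{k\<in>K. k \<ge> 0} \<union> {k\<in>K. k < 0}. g (nat \<bar>k\<bar>))"
    by (intro sum.cong) auto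
  also have "\<dots> = (\<Sum>k\<in>{k\<in>K. k \<ge> 0}. g (nat \<bar>k\<bar>)) + (\<Sum>k\<in>{k\<in>K. k < 0}. g (nat \<bar>k\<bar>))"
    using assms(1) by (intro sum.union_disjoint) auto
  also have "\<dots> \<le> suminf g + suminf g"
    using assms(1) by (intro add_mono half) (auto simp: inj_on_def)
  finally show ?thesis by simp
qed

lemma summable_quadratic_geometric:
  fixes q :: real
  assumes "0 \<le> q" "q < 1"
  shows "summable (\<lambda>n. real (n + 1) * real (n + 2) * q ^ n)"
proof -
  have "summable (\<lambda>n. diffs (diffs (\<lambda>_. 1)) n * q ^ n)"
  proof (rule termdiff_converges[where K = 1])
    fix x :: real assume "norm x < 1"
    thus "summable (\<lambda>n. diffs (\<lambda>_. 1) n * x ^ n)"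
      by (rule termdiff_converges) (simp add: summable_geometric)
  qed (use assms in simp)
  thus ?thesis by (simp add: diffs_def mult_ac)
qed

lemma norm_T2_mode_le:
  assumes "norm z \<le> s" "s \<le> 1"
  shows "norm (T2_mode k z) \<le> real (nat \<bar>k\<bar> + 1) * s ^ nat \<bar>k\<bar>"
proof -
  define n where "n = nat \<bar>k\<bar>"
  have n: "\<bar>k\<bar> = int n" unfolding n_def by simp
  have "norm (of_int (\<bar>k\<bar> + 1) - of_int (\<bar>k\<bar> - 1) * (z * cnj z) :: complex)
     \<le> real (n + 1) + \<bar>real n - 1\<bar> * (norm z * norm z)"
  proof -
    have "of_int (\<bar>k\<bar> + 1) = complex_of_real (real (n + 1))" "of_int (\<bar>k\<bar> - 1) = complex_of_real (real n - 1)"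
      unfolding n by simp_all
    hence "norm (of_int (\<bar>k\<bar> + 1) :: complex) = real (n + 1)" "norm (of_int (\<bar>k\<bar> - 1) :: complex) = \<bar>real n - 1\<bar>"
      by (simp_all only: norm_of_real abs_of_nat)
    thus ?thesis
      using norm_triangle_ineq4[of "of_int (\<bar>k\<bar> + 1)" "of_int (\<bar>k\<bar> - 1) * (z * cnj z)"]
      by (simp only: norm_mult complex_mod_cnj)
  qed
  also have "\<dots> \<le> real (n + 1) + real (n + 1) * 1"
    using assms by (intro add_left_mono mult_mono mult_le_one) auto
  finally have 1: "norm (of_int (\<bar>k\<bar> + 1) - of_int (\<bar>k\<bar> - 1) * (z * cnj z) :: complex) / 2 \<le> real (n + 1)"
    by simp
  have "norm (T2_mode k z) = norm z ^ n * (norm (of_int (\<bar>k\<bar> + 1) - of_int (\<bar>k\<bar> - 1) * (z * cnj z) :: complex) / 2)"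
    unfolding T2_mode_def n_def[symmetric] by (simp add: norm_mult norm_divide norm_power)
  also have "\<dots> \<le> s ^ n * real (n + 1)"
    using assms 1 order_trans[OF norm_ge_zero assms(1)] by (intro mult_mono power_mono) auto
  finally show ?thesis unfolding n_def by (simp add: mult.commute)
qed

text \<open>
  The factor \<open>d\<close> of the \<open>n\<close>-th mode on the circle of radius \<open>R\<close> (see \<open>T2_mode_on_circle\<close>)
  tends to \<open>1\<close> as \<open>R\<close> tends to \<open>1\<close>, with an error linear in \<open>1 - R\<close> that grows only linearly in \<open>n\<close>.
\<close>
lemma circle_factor_bounds:
  fixes R :: real and n :: nat
  assumes "0 < R" "R < 1"
  defines "d \<equiv> R ^ n * (real n + 1 - (real n - 1) * R\<^sup>2) / 2"
  shows "R ^ (n + 2) \<le> d" "\<bar>1 - d\<bar> \<le> real (n + 2) * (1 - R)"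
proof -
  have R2: "R\<^sup>2 \<le> 1" using assms by (simp add: power_le_one)
  have d: "d = R ^ n * ((1 + R\<^sup>2) / 2 + real n * ((1 - R\<^sup>2) / 2))"
    unfolding d_def by (simp add: field_simps)
  have "R\<^sup>2 \<le> (1 + R\<^sup>2) / 2 + real n * ((1 - R\<^sup>2) / 2)"
    using R2 by (intro add_increasing2) auto
  from mult_left_mono[OF this, of "R ^ n"] show low: "R ^ (n + 2) \<le> d"
    unfolding d using assms(1,2) by (simp add: power_add power2_eq_square)
  have "d \<le> 1 * ((1 + R\<^sup>2) / 2 + real n * ((1 - R\<^sup>2) / 2))"
    unfolding d using assms R2 by (intro mult_right_mono power_le_one add_nonneg_nonneg) auto
  also have "\<dots> \<le> 1 + real n * (1 - R)"
  proof -
    have "(1 - R\<^sup>2) / 2 \<le> 1 - R" using zero_le_power2[of "1 - R"] by (simp add: power2_diff)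
    thus ?thesis unfolding mult_1 using R2 by (intro add_mono mult_left_mono) auto
  qed
  finally have up: "d \<le> 1 + real n * (1 - R)" .
  have "1 + real (n + 2) * (R - 1) \<le> (1 + (R - 1)) ^ (n + 2)"
    by (rule Bernoulli_inequality) (use assms in simp)
  hence "1 - real (n + 2) * (1 - R) \<le> d" using low by (simp add: algebra_simps)
  moreover have "real n * (1 - R) \<le> real (n + 2) * (1 - R)" using assms by (intro mult_right_mono) auto
  ultimately show "\<bar>1 - d\<bar> \<le> real (n + 2) * (1 - R)" using up by linarith
qed

text \<open>
  The operator is not invariant under dilations, so \<open>u\<close> cannot be replaced by \<open>u (r z)\<close> to obtain boundary
  values. Instead, approximate \<open>u\<close> on the circle of radius \<open>R\<close> by a Laurent sum in \<open>\<zeta> = z / R\<close>. With the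
  coefficients divided by the circle factors \<open>d k\<close> it extends to a solution \<open>U\<close> that is close to \<open>u\<close> by the
  maximum principle. Dropping the division costs a relative error of order \<open>(|k| + 2) (1 - R) / R ^ (|k| + 2)\<close>
  in the \<open>k\<close>-th term, and the decay of the modes for \<open>|z| \<le> s < 1\<close> makes the sum of these errors small
  uniformly in the number of terms. What remains is the sum of modes with boundary values bounded by
  \<open>1 + e\<close> on the unit circle itself.
\<close>
lemma T_harmonic_2_approximation:
  assumes u: "T_harmonic 2 u" and bd: "\<And>z. norm z < 1 \<Longrightarrow> norm (u z) \<le> 1"
    and s: "0 \<le> s" "s < 1" and e: "e > 0"
  obtains K c where "finite K" "\<And>\<zeta>. norm \<zeta> = 1 \<Longrightarrow> norm (laurent_sum K c \<zeta>) \<le> 1 + e"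
    "\<And>z. norm z \<le> s \<Longrightarrow> norm (u z - (\<Sum>k\<in>K. c k * T2_mode k z)) \<le> e"
proof -
  \<comment> \<open>Since \<open>s = q * q\<close> and \<open>q \<le> R\<close>, half of the decay of \<open>s ^ n\<close> absorbs \<open>R ^ -n\<close> and a summable \<open>q ^ n\<close> is left.\<close>
  define q where "q = sqrt s"
  have q: "0 \<le> q" "q < 1" "q * q = s" unfolding q_def using s by auto
  define g where "g = (\<lambda>n. real (n + 1) * real (n + 2) * q ^ n)"
  have g: "summable g" "\<And>n. 0 \<le> g n"
    unfolding g_def using q summable_quadratic_geometric[of q] by auto
  define S where "S = suminf g"
  have S: "0 \<le> S" unfolding S_def using g by (intro suminf_nonneg)
  define R where "R = max (max q (1/2)) (1 - e / (16 * (1 + e) * (S + 1)))"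
  have "e / (16 * (1 + e) * (S + 1)) > 0" using e S by (intro divide_pos_pos mult_pos_pos) auto
  hence R: "q \<le> R" "1/2 \<le> R" "R < 1" "1 - R \<le> e / (16 * (1 + e) * (S + 1))"
    unfolding R_def using q by linarith+
  have "(1 - R) * (16 * (1 + e) * (S + 1)) \<le> e"
    using R(4) e S by (subst (asm) pos_le_divide_eq) (auto intro!: mult_pos_pos)
  moreover have "(1 - R) * (16 * (1 + e) * S) \<le> (1 - R) * (16 * (1 + e) * (S + 1))"
    using R e by (intro mult_left_mono) auto
  ultimately have small: "(1 - R) * (16 * (1 + e) * S) \<le> e" by linarith
  have "continuous_on (ball 0 1) u"
    by (rule continuous_on_wirtinger[OF T_harmonic_2D(3)[OF u]])
  hence "continuous_on (sphere 0 1) (\<lambda>\<zeta>. u (of_real R * \<zeta>))"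
    by (rule continuous_on_compose2[of "ball 0 1" u "sphere 0 1" "\<lambda>\<zeta>. of_real R * \<zeta>"])
      (use R in \<open>auto simp: norm_mult intro!: continuous_on_mult_left continuous_on_id\<close>)
  then obtain K c where K: "finite K"
    and L: "\<And>\<zeta>. norm \<zeta> = 1 \<Longrightarrow> norm (u (of_real R * \<zeta>) - laurent_sum K c \<zeta>) < e / 2"
    using laurent_sum_approximation[of "\<lambda>\<zeta>. u (of_real R * \<zeta>)" "e / 2"] e by auto
  have L1: "norm (laurent_sum K c \<zeta>) \<le> 1 + e" if "norm \<zeta> = 1" for \<zeta>
  proof -
    have "norm (u (of_real R * \<zeta>)) \<le> 1" using that R by (intro bd) (simp add: norm_mult)
    thus ?thesis using L[OF that] norm_triangle_ineq3[of "u (of_real R * \<zeta>)" "laurent_sum K c \<zeta>"] e by linarith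
  qed
  define d where "d = (\<lambda>k::int. R ^ nat \<bar>k\<bar> * (\<bar>k\<bar> + 1 - (\<bar>k\<bar> - 1) * R\<^sup>2) / 2)"
  have d: "R ^ (nat \<bar>k\<bar> + 2) \<le> d k" "\<bar>1 - d k\<bar> \<le> real (nat \<bar>k\<bar> + 2) * (1 - R)" for k
    using circle_factor_bounds[of R "nat \<bar>k\<bar>"] R unfolding d_def by auto
  have Rpos: "R ^ n > 0" for n using R by simp
  have d0: "d k > 0" for k using d(1)[of k] Rpos[of "nat \<bar>k\<bar> + 2"] by linarith
  define U where "U = (\<lambda>z. \<Sum>k\<in>K. c k / of_real (d k) * T2_mode k z)"
  have U: "T_harmonic 2 U"
    unfolding U_def by (intro T_harmonic_2_sum T_harmonic_T2_mode)
  have UR: "U (of_real R * \<zeta>) = laurent_sum K c \<zeta>" if "norm \<zeta> = 1" for \<zeta>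
  proof -
    have "T2_mode k (of_real R * \<zeta>) = of_real (d k) * \<zeta> powi k" for k
      unfolding d_def using T2_mode_on_circle[OF that, of k R] by simp
    thus ?thesis
      unfolding U_def laurent_sum_def using d0 by (intro sum.cong refl) (simp add: less_imp_neq[symmetric])
  qed
  have uU: "norm (u z - U z) \<le> e / 2" if "norm z \<le> R" for z
  proof -
    have "norm (1 * u z + (- 1) * U z) \<le> e / 2"
    proof (rule T_harmonic_2_maximum_principle[OF T_harmonic_2_linear[OF u U] R(3) _ _ that])
      fix w :: complex assume w: "norm w = R"
      define \<zeta> where "\<zeta> = w / of_real R"
      have "norm \<zeta> = 1" "w = of_real R * \<zeta>" unfolding \<zeta>_def using w R by (auto simp: norm_divide)
      thus "norm (1 * u w + (- 1) * U w) \<le> e / 2" using L[of \<zeta>] UR[of \<zeta>] by simp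
    qed (use e in simp)
    thus ?thesis by simp
  qed
  have UV: "norm (U z - (\<Sum>k\<in>K. c k * T2_mode k z)) \<le> e / 2" if z: "norm z \<le> s" for z
  proof -
    have "norm (U z - (\<Sum>k\<in>K. c k * T2_mode k z)) \<le> (\<Sum>k\<in>K. 4 * (1 + e) * (1 - R) * g (nat \<bar>k\<bar>))"
      unfolding U_def sum_subtractf[symmetric]
    proof (rule sum_norm_le)
      fix k assume k: "k \<in> K"
      define n where "n = nat \<bar>k\<bar>"
      have c: "norm (c k) \<le> 1 + e" by (rule norm_laurent_coeff_le[OF K k L1])
      have m: "norm (T2_mode k z) \<le> real (n + 1) * s ^ n"
        unfolding n_def using norm_T2_mode_le[OF z] s by simp
      have "s ^ n \<le> q ^ n * R ^ n" unfolding q(3)[symmetric] power_mult_distrib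
        using q R by (intro mult_left_mono power_mono) auto
      also have "\<dots> \<le> 4 * q ^ n * R ^ (n + 2)"
      proof -
        have "1 \<le> 4 * R\<^sup>2" using power_mono[OF R(2), of 2] by (simp add: power2_eq_square)
        from mult_left_mono[OF this, of "q ^ n * R ^ n"] show ?thesis
          using q R by (simp add: power_add power2_eq_square mult_ac)
      qed
      also have "\<dots> \<le> 4 * q ^ n * d k"
        using q d(1)[of k] unfolding n_def by (intro mult_left_mono) auto
      finally have sd: "s ^ n / d k \<le> 4 * q ^ n" using d0[of k] by (simp add: field_simps)
      have "c k / of_real (d k) * T2_mode k z - c k * T2_mode k z
          = c k * of_real (1 - d k) * T2_mode k z / of_real (d k)"
        using d0[of k] by (simp add: field_simps)
      hence "norm (c k / of_real (d k) * T2_mode k z - c k * T2_mode k z)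
          = norm (c k) * \<bar>1 - d k\<bar> * norm (T2_mode k z) / d k"
        using d0[of k] by (simp add: norm_mult norm_divide del: of_real_diff)
      also have "\<dots> \<le> (1 + e) * (real (n + 2) * (1 - R)) * (real (n + 1) * s ^ n) / d k"
        using c m d(2)[of k] d0[of k] e unfolding n_def
        by (intro divide_right_mono mult_mono) auto
      also have "\<dots> = (1 + e) * (1 - R) * (real (n + 1) * real (n + 2)) * (s ^ n / d k)" by simp
      also have "\<dots> \<le> (1 + e) * (1 - R) * (real (n + 1) * real (n + 2)) * (4 * q ^ n)"
        using sd e R by (intro mult_left_mono) auto
      also have "\<dots> = 4 * (1 + e) * (1 - R) * g n" unfolding g_def by simp
      finally show "norm (c k / of_real (d k) * T2_mode k z - c k * T2_mode k z)
         \<le> 4 * (1 + e) * (1 - R) * g (nat \<bar>k\<bar>)" unfolding n_def .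
    qed
    also have "\<dots> = 4 * (1 + e) * (1 - R) * (\<Sum>k\<in>K. g (nat \<bar>k\<bar>))"
      by (simp add: sum_distrib_left)
    also have "\<dots> \<le> 4 * (1 + e) * (1 - R) * (2 * S)"
      unfolding S_def using e R by (intro mult_left_mono sum_nat_abs_le_suminf K g) auto
    also have "\<dots> = (1 - R) * (16 * (1 + e) * S) / 2" by simp
    also have "\<dots> \<le> e / 2" using small by simp
    finally show ?thesis .
  qed
  have sR: "s \<le> R"
  proof -
    have "q * q \<le> q * 1" using q by (intro mult_left_mono) auto
    thus ?thesis using q R by simp
  qed
  show ?thesis
  proof (rule that[OF K L1])
    fix z :: complex assume z: "norm z \<le> s"
    show "norm (u z - (\<Sum>k\<in>K. c k * T2_mode k z)) \<le> e"
      using uU[of z] UV[OF z] z sR norm_triangle_ineq[of "u z - U z" "U z - (\<Sum>k\<in>K. c k * T2_mode k z)"]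
      by simp
  qed
qed

text \<open>
  This replaces a Poisson representation of \<open>u\<close>: the approximating sums are Poisson integrals, and the
  estimate survives the limit although no boundary function of \<open>u\<close> is constructed.
\<close>
lemma T_harmonic_2_oscillation:
  assumes u: "T_harmonic 2 u" and bd: "\<And>z. norm z < 1 \<Longrightarrow> norm (u z) \<le> 1"
    and z: "norm z < 1" and w: "norm w < 1"
  shows "norm (u z - u w) \<le> circle_mean (\<lambda>\<zeta>. \<bar>T2_poisson z \<zeta> - T2_poisson w \<zeta>\<bar>)" (is "_ \<le> ?A")
proof -
  note cont = continuous_on_T2_poisson[OF z] continuous_on_T2_poisson[OF w]
  have bound: "norm (u z - u w) \<le> 2 * e + (1 + e) * ?A" if e: "e > 0" for e
  proof -
    define s where "s = max (norm z) (norm w)"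
    have s: "0 \<le> s" "s < 1" "norm z \<le> s" "norm w \<le> s"
      unfolding s_def using z w by (auto simp: le_max_iff_disj)
    obtain K c where K: "finite K" and L: "\<And>\<zeta>. norm \<zeta> = 1 \<Longrightarrow> norm (laurent_sum K c \<zeta>) \<le> 1 + e"
      and V: "\<And>z. norm z \<le> s \<Longrightarrow> norm (u z - (\<Sum>k\<in>K. c k * T2_mode k z)) \<le> e"
      using T_harmonic_2_approximation[OF u bd s(1,2) e] by blast
    define V where "V = (\<lambda>z. \<Sum>k\<in>K. c k * T2_mode k z)"
    have "V z - V w = circle_mean (\<lambda>\<zeta>. of_real (T2_poisson z \<zeta>) * laurent_sum K c \<zeta>
        - of_real (T2_poisson w \<zeta>) * laurent_sum K c \<zeta>)"
      unfolding V_def circle_mean_poisson_laurent[OF z K, symmetric] circle_mean_poisson_laurent[OF w K, symmetric]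
      by (rule circle_mean_diff[symmetric]) (intro continuous_intros cont continuous_on_laurent_sum)+
    also have "norm \<dots> \<le> circle_mean (\<lambda>\<zeta>. (1 + e) * \<bar>T2_poisson z \<zeta> - T2_poisson w \<zeta>\<bar>)"
    proof (rule norm_circle_mean_le)
      fix \<zeta> :: complex assume \<zeta>: "norm \<zeta> = 1"
      have "norm (of_real (T2_poisson z \<zeta>) * laurent_sum K c \<zeta> - of_real (T2_poisson w \<zeta>) * laurent_sum K c \<zeta>)
         = \<bar>T2_poisson z \<zeta> - T2_poisson w \<zeta>\<bar> * norm (laurent_sum K c \<zeta>)"
        unfolding left_diff_distrib[symmetric] of_real_diff[symmetric] by (simp only: norm_mult norm_of_real)
      also have "\<dots> \<le> \<bar>T2_poisson z \<zeta> - T2_poisson w \<zeta>\<bar> * (1 + e)"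
        by (intro mult_left_mono L \<zeta>) auto
      finally show "norm (of_real (T2_poisson z \<zeta>) * laurent_sum K c \<zeta> - of_real (T2_poisson w \<zeta>) * laurent_sum K c \<zeta>)
         \<le> (1 + e) * \<bar>T2_poisson z \<zeta> - T2_poisson w \<zeta>\<bar>" by (simp add: mult.commute)
    qed (intro continuous_intros cont continuous_on_laurent_sum)+
    also have "\<dots> = (1 + e) * ?A"
      by (rule circle_mean_linear[OF bounded_linear_mult_right]) (intro continuous_intros cont)
    finally have "norm (V z - V w) \<le> (1 + e) * ?A" .
    moreover have "norm (u z - V z) \<le> e" "norm (u w - V w) \<le> e"
      unfolding V_def by (intro V s)+
    moreover have "u z - u w = (u z - V z) + (V z - V w) - (u w - V w)" by simp
    ultimately show ?thesis
      using norm_triangle_ineq4[of "(u z - V z) + (V z - V w)" "u w - V w"]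
        norm_triangle_ineq[of "u z - V z" "V z - V w"] by simp
  qed
  show ?thesis
  proof (rule tendsto_lowerbound)
    have "((\<lambda>e. 2 * e + (1 + e) * ?A) \<longlongrightarrow> 2 * 0 + (1 + 0) * ?A) (at_right 0)"
      by (intro tendsto_intros)
    thus "((\<lambda>e. 2 * e + (1 + e) * ?A) \<longlongrightarrow> ?A) (at_right 0)" by simp
    show "\<forall>\<^sub>F e in at_right 0. norm (u z - u w) \<le> 2 * e + (1 + e) * ?A"
      by (rule eventually_at_rightI[of 0 1]) (use bound in auto)
  qed simp
qed

section \<open>Gradient estimate\<close>

text \<open>
  The derivative of \<open>\<lambda>z. T2_poisson z \<zeta>\<close> at \<open>z\<close> in direction \<open>h\<close>.
\<close>
definition T2_poisson_deriv :: "complex \<Rightarrow> complex \<Rightarrow> complex \<Rightarrow> real" where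
  "T2_poisson_deriv z h \<zeta> = (1 - (norm z)\<^sup>2)\<^sup>2 / norm (\<zeta> - z) ^ 4 *
     (2 * (1 - (norm z)\<^sup>2) * Re (cnj (\<zeta> - z) * h) / (norm (\<zeta> - z))\<^sup>2 - 3 * Re (cnj z * h))"

lemma DERIV_norm_square_line:
  "((\<lambda>t. (norm (a + of_real t * h))\<^sup>2) has_real_derivative 2 * Re (cnj (a + of_real t * h) * h)) (at t)"
  unfolding cmod_power2
  by (auto intro!: derivative_eq_intros simp: algebra_simps)

lemma DERIV_T2_poisson:
  assumes "\<zeta> \<noteq> z + of_real t * h"
  shows "((\<lambda>t. T2_poisson (z + of_real t * h) \<zeta>) has_real_derivative
     T2_poisson_deriv (z + of_real t * h) h \<zeta>) (at t)"
proof -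
  define N where "N = (\<lambda>t. 1 - (norm (z + complex_of_real t * h))\<^sup>2)"
  define Q where "Q = (\<lambda>t. (norm ((\<zeta> - z) + complex_of_real t * (- h)))\<^sup>2)"
  define A where "A = Re (cnj (z + of_real t * h) * h)"
  define B where "B = Re (cnj (\<zeta> - (z + of_real t * h)) * h)"
  have N: "(N has_real_derivative - 2 * A) (at t)"
    unfolding N_def A_def using DERIV_diff[OF DERIV_const DERIV_norm_square_line, of 1] by simp
  have Q: "(Q has_real_derivative - 2 * B) (at t)"
    unfolding Q_def B_def using DERIV_norm_square_line[of "\<zeta> - z" "- h" t] by (simp add: algebra_simps)
  have Q0: "Q t \<noteq> 0" using assms unfolding Q_def by (simp add: algebra_simps)
  have "((\<lambda>t. N t ^ 3 / (2 * Q t ^ 2)) has_real_derivative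
     ((3 * (N t)\<^sup>2 * (- 2 * A)) * (2 * Q t ^ 2) - N t ^ 3 * (2 * (2 * Q t * (- 2 * B)))) /
       ((2 * Q t ^ 2) * (2 * Q t ^ 2))) (at t)"
    using Q0 by (auto intro!: derivative_eq_intros N Q simp: power2_eq_square)
  moreover have "((3 * (N t)\<^sup>2 * (- 2 * A)) * (2 * Q t ^ 2) - N t ^ 3 * (2 * (2 * Q t * (- 2 * B)))) /
       ((2 * Q t ^ 2) * (2 * Q t ^ 2)) = (N t)\<^sup>2 / Q t ^ 2 * (2 * N t * B / Q t - 3 * A)"
    using Q0 by (simp add: field_simps power2_eq_square power3_eq_cube)
  moreover have "T2_poisson (z + of_real t * h) \<zeta> = N t ^ 3 / (2 * Q t ^ 2)" for t
    unfolding T2_poisson_def N_def Q_def power_mult[symmetric] by (simp add: algebra_simps)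
  moreover have "T2_poisson_deriv (z + of_real t * h) h \<zeta> = (N t)\<^sup>2 / Q t ^ 2 * (2 * N t * B / Q t - 3 * A)"
    unfolding T2_poisson_deriv_def N_def Q_def A_def B_def power_mult[symmetric] by (simp add: algebra_simps)
  ultimately show ?thesis by simp
qed

lemma continuous_on_T2_poisson_deriv:
  assumes "norm z < 1"
  shows "continuous_on (sphere 0 1) (T2_poisson_deriv z h)"
  unfolding T2_poisson_deriv_def[abs_def] by (intro continuous_intros) (use assms in auto)

text \<open>
  The oscillation estimate for \<open>z\<close> and \<open>z + t h\<close>, divided by \<open>t\<close>. The difference quotients of the kernel are
  controlled uniformly in \<open>\<zeta>\<close>, because the derivative of the kernel is uniformly continuous on a compact
  set of pairs \<open>(t, \<zeta>)\<close>.
\<close>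
lemma T_harmonic_2_derivative_bound:
  assumes u: "T_harmonic 2 u" and bd: "\<And>z. norm z < 1 \<Longrightarrow> norm (u z) \<le> 1"
    and z: "norm z < 1"
  shows "norm (frechet_derivative u (at z) h) \<le> circle_mean (\<lambda>\<zeta>. \<bar>T2_poisson_deriv z h \<zeta>\<bar>)" (is "_ \<le> ?A")
proof (rule field_le_epsilon)
  fix e' :: real assume "e' > 0"
  define e where "e = e' / (1 + norm h)"
  have "1 + norm h > 0" by (simp add: add_pos_nonneg)
  hence e: "e > 0" "e * (1 + norm h) = e'" unfolding e_def using \<open>e' > 0\<close> by auto
  define D where "D = frechet_derivative u (at z)"
  have "u differentiable (at z)"
    by (rule wirtinger_partials(1)[OF T_harmonic_2D(3)[OF u]]) (use z in simp)
  hence D: "(u has_derivative D) (at z)" unfolding D_def by (simp add: frechet_derivative_works)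
  interpret D: linear D using D has_derivative_linear by blast
  obtain d where d: "d > 0" "\<And>y. norm (y - z) < d \<Longrightarrow> norm (u y - u z - D (y - z)) \<le> e * norm (y - z)"
    using D e(1) unfolding has_derivative_at_alt by blast
  \<comment> \<open>Steps \<open>t h\<close> with \<open>t \<le> \<tau>\<close> are at most half the distance to the unit circle.\<close>
  define \<tau> where "\<tau> = (1 - norm z) / (2 * (1 + norm h))"
  have \<tau>: "\<tau> > 0" unfolding \<tau>_def using z \<open>1 + norm h > 0\<close> by simp
  have inside: "norm (z + of_real t * h) < 1" if "0 \<le> t" "t \<le> \<tau>" for t
  proof -
    have "norm (of_real t * h) \<le> \<tau> * (1 + norm h)"
      unfolding norm_mult using that by (intro mult_mono) auto
    also have "\<dots> = (1 - norm z) / 2" unfolding \<tau>_def using \<open>1 + norm h > 0\<close> by (simp add: field_simps)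
    also have "\<dots> < 1 - norm z" using z by simp
    finally show ?thesis using norm_triangle_ineq[of z "of_real t * h"] by simp
  qed
  have ne: "\<zeta> \<noteq> z + of_real t * h" if "norm \<zeta> = 1" "0 \<le> t" "t \<le> \<tau>" for \<zeta> t
    using inside[OF that(2,3)] that(1) by auto
  have "continuous_on ({0..\<tau>} \<times> sphere 0 1) (\<lambda>x. T2_poisson_deriv (z + of_real (fst x) * h) h (snd x))"
    unfolding T2_poisson_deriv_def by (intro continuous_intros) (use ne in auto)
  hence "uniformly_continuous_on ({0..\<tau>} \<times> sphere 0 1) (\<lambda>x. T2_poisson_deriv (z + of_real (fst x) * h) h (snd x))"
    by (intro compact_uniformly_continuous compact_Times) auto
  then obtain r where r: "r > 0" and unif: "\<And>x y. x \<in> {0..\<tau>} \<times> sphere 0 1 \<Longrightarrow> y \<in> {0..\<tau>} \<times> sphere 0 1 \<Longrightarrow>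
      dist y x < r \<Longrightarrow> dist (T2_poisson_deriv (z + of_real (fst y) * h) h (snd y))
         (T2_poisson_deriv (z + of_real (fst x) * h) h (snd x)) < e"
    unfolding uniformly_continuous_on_def using e(1) by metis
  have near: "\<bar>T2_poisson_deriv (z + of_real t * h) h \<zeta>\<bar> \<le> \<bar>T2_poisson_deriv z h \<zeta>\<bar> + e"
    if "0 \<le> t" "t \<le> \<tau>" "t < r" "norm \<zeta> = 1" for t \<zeta>
  proof -
    have "dist (t, \<zeta>) (0, \<zeta>) < r" using that by (simp add: dist_Pair_Pair dist_norm)
    thus ?thesis using unif[of "(0, \<zeta>)" "(t, \<zeta>)"] that \<tau> by (simp add: dist_real_def)
  qed
  define t where "t = min (min \<tau> (r / 2)) (d / (2 * (1 + norm h)))"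
  have t: "0 < t" "t \<le> \<tau>" "t < r" "t \<le> d / (2 * (1 + norm h))"
    unfolding t_def using \<tau> r d(1) \<open>1 + norm h > 0\<close> by (simp_all add: min_less_iff_disj)
  have "t * norm h < d"
  proof -
    have "t * norm h \<le> d / (2 * (1 + norm h)) * (1 + norm h)"
      using t by (intro mult_mono) auto
    also have "\<dots> = d / 2" using \<open>1 + norm h > 0\<close> by (simp add: field_simps)
    also have "\<dots> < d" using d(1) by simp
    finally show ?thesis .
  qed
  hence lin: "norm (u (z + of_real t * h) - u z - D (of_real t * h)) \<le> e * (t * norm h)"
    using d(2)[of "z + of_real t * h"] t by (simp add: norm_mult)
  have lip: "\<bar>T2_poisson (z + of_real t * h) \<zeta> - T2_poisson z \<zeta>\<bar> \<le> t * (\<bar>T2_poisson_deriv z h \<zeta>\<bar> + e)"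
    if \<zeta>: "norm \<zeta> = 1" for \<zeta>
  proof -
    obtain x where x: "0 < x" "x < t" "T2_poisson (z + of_real t * h) \<zeta> - T2_poisson (z + of_real 0 * h) \<zeta>
        = (t - 0) * T2_poisson_deriv (z + of_real x * h) h \<zeta>"
      using MVT2[OF t(1), of "\<lambda>t. T2_poisson (z + of_real t * h) \<zeta>" "\<lambda>t. T2_poisson_deriv (z + of_real t * h) h \<zeta>"]
        DERIV_T2_poisson[OF ne[OF \<zeta>]] t by auto
    have "\<bar>T2_poisson (z + of_real t * h) \<zeta> - T2_poisson z \<zeta>\<bar> = t * \<bar>T2_poisson_deriv (z + of_real x * h) h \<zeta>\<bar>"
      using x t by (simp add: abs_mult)
    also have "\<dots> \<le> t * (\<bar>T2_poisson_deriv z h \<zeta>\<bar> + e)"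
      using x t \<zeta> by (intro mult_left_mono near) auto
    finally show ?thesis .
  qed
  note cont = continuous_on_T2_poisson_deriv[OF z] continuous_on_T2_poisson[OF z]
    continuous_on_T2_poisson[OF inside[OF less_imp_le[OF t(1)] t(2)]]
  have "norm (u (z + of_real t * h) - u z) \<le>
      circle_mean (\<lambda>\<zeta>. \<bar>T2_poisson (z + of_real t * h) \<zeta> - T2_poisson z \<zeta>\<bar>)"
    by (rule T_harmonic_2_oscillation[OF u bd inside[OF less_imp_le[OF t(1)] t(2)] z])
  also have "\<dots> \<le> circle_mean (\<lambda>\<zeta>. t * (\<bar>T2_poisson_deriv z h \<zeta>\<bar> + e))"
    by (rule circle_mean_mono[OF _ _ lip]) (intro continuous_intros cont)+
  also have "\<dots> = t * circle_mean (\<lambda>\<zeta>. \<bar>T2_poisson_deriv z h \<zeta>\<bar> + e)"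
    by (rule circle_mean_linear[OF bounded_linear_mult_right]) (intro continuous_intros cont)
  also have "circle_mean (\<lambda>\<zeta>. \<bar>T2_poisson_deriv z h \<zeta>\<bar> + e) = ?A + e"
    using circle_mean_add[OF continuous_on_rabs[OF cont(1)] continuous_on_const] by (simp only: circle_mean_const)
  finally have "norm (u (z + of_real t * h) - u z) \<le> t * (?A + e)" .
  moreover have "norm (D (of_real t * h)) = t * norm (D h)"
    using D.scale[of t h] t by (simp add: scaleR_conv_of_real norm_mult)
  moreover have "norm (D (of_real t * h)) \<le> norm (u (z + of_real t * h) - u z)
      + norm (u (z + of_real t * h) - u z - D (of_real t * h))"
    using norm_triangle_ineq4[of "u (z + of_real t * h) - u z" "u (z + of_real t * h) - u z - D (of_real t * h)"]
    by simp
  ultimately have "t * norm (D h) \<le> t * (?A + e) + e * (t * norm h)" using lin by linarith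
  also have "\<dots> = t * (?A + e * (1 + norm h))" by (simp add: algebra_simps)
  finally show "norm (frechet_derivative u (at z) h) \<le> ?A + e'"
    using t(1) unfolding e(2) D_def by simp
qed

lemma circle_mean_T2_poisson:
  assumes "norm z < 1"
  shows "circle_mean (T2_poisson z) = (1 + (norm z)\<^sup>2) / 2"
proof -
  have "complex_of_real (circle_mean (T2_poisson z)) = circle_mean (\<lambda>\<zeta>. of_real (T2_poisson z \<zeta>))"
    by (rule circle_mean_linear[OF bounded_linear_of_real continuous_on_T2_poisson[OF assms], symmetric])
  also have "\<dots> = (1 + z * cnj z) / 2"
    using circle_mean_poisson_powi[OF assms, of 0] by (simp add: T2_mode_def)
  also have "\<dots> = complex_of_real ((1 + (norm z)\<^sup>2) / 2)"
    by (simp add: complex_norm_square[symmetric])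
  finally show ?thesis using of_real_eq_iff by blast
qed

text \<open>
  The two terms of the derivative contribute \<open>2 (1 + |z|)\<close> and \<open>3 |z|\<close>: the first because
  \<open>1 - |z|\<^sup>2 \<le> (1 + |z|) |\<zeta> - z|\<close>. The remaining factor \<open>(1 - |z|\<^sup>2)\<^sup>2 / |\<zeta> - z| ^ 4\<close> is a multiple of the kernel,
  whose mean is known.
\<close>
lemma T2_poisson_deriv_bound:
  assumes z: "norm z < 1" and \<zeta>: "norm \<zeta> = 1"
  shows "\<bar>T2_poisson_deriv z h \<zeta>\<bar> \<le> (2 + 5 * norm z) * norm h * (2 / (1 - (norm z)\<^sup>2)) * T2_poisson z \<zeta>"
proof -
  define N where "N = 1 - (norm z)\<^sup>2"
  define Q where "Q = norm (\<zeta> - z)"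
  have Nfac: "N = (1 - norm z) * (1 + norm z)" unfolding N_def by (simp add: power2_eq_square algebra_simps)
  have N: "N > 0" unfolding Nfac using z by (intro mult_pos_pos) (auto simp: add_pos_nonneg)
  have Q1: "1 - norm z \<le> Q" unfolding Q_def using norm_triangle_ineq2[of \<zeta> z] \<zeta> by simp
  hence Q: "Q > 0" using z by simp
  have NQ: "N / Q \<le> 1 + norm z"
    using mult_right_mono[OF Q1, of "1 + norm z"] by (simp add: pos_divide_le_eq[OF Q] Nfac mult.commute)
  have "\<bar>2 * N * Re (cnj (\<zeta> - z) * h) / Q\<^sup>2\<bar> \<le> 2 * N * (Q * norm h) / Q\<^sup>2"
  proof -
    have "\<bar>Re (cnj (\<zeta> - z) * h)\<bar> \<le> Q * norm h"
      unfolding Q_def using abs_Re_le_cmod[of "cnj (\<zeta> - z) * h"] by (simp only: norm_mult complex_mod_cnj)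
    thus ?thesis using N Q by (simp add: abs_mult divide_right_mono)
  qed
  also have "\<dots> = 2 * (N / Q) * norm h" using Q by (simp add: power2_eq_square)
  also have "\<dots> \<le> 2 * (1 + norm z) * norm h" using NQ by (intro mult_right_mono mult_left_mono) auto
  finally have 1: "\<bar>2 * N * Re (cnj (\<zeta> - z) * h) / Q\<^sup>2\<bar> \<le> 2 * (1 + norm z) * norm h" .
  have 2: "\<bar>3 * Re (cnj z * h)\<bar> \<le> 3 * (norm z * norm h)"
    using abs_Re_le_cmod[of "cnj z * h"] by (simp only: norm_mult complex_mod_cnj abs_mult abs_numeral)
  have "\<bar>2 * N * Re (cnj (\<zeta> - z) * h) / Q\<^sup>2 - 3 * Re (cnj z * h)\<bar> \<le> (2 + 5 * norm z) * norm h"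
    using abs_triangle_ineq4[of "2 * N * Re (cnj (\<zeta> - z) * h) / Q\<^sup>2" "3 * Re (cnj z * h)"] 1 2
    by (simp only: ring_distribs)
  hence "N\<^sup>2 / Q ^ 4 * \<bar>2 * N * Re (cnj (\<zeta> - z) * h) / Q\<^sup>2 - 3 * Re (cnj z * h)\<bar>
      \<le> N\<^sup>2 / Q ^ 4 * ((2 + 5 * norm z) * norm h)"
    by (intro mult_left_mono) auto
  also have "N\<^sup>2 / Q ^ 4 * ((2 + 5 * norm z) * norm h) =
      (2 + 5 * norm z) * norm h * (2 / N) * (N ^ 3 / (2 * Q ^ 4))"
    using N Q by (simp add: field_simps power2_eq_square power3_eq_cube)
  finally show ?thesis
    unfolding T2_poisson_deriv_def T2_poisson_def N_def[symmetric] Q_def[symmetric] by (simp add: abs_mult)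
qed

lemma T_harmonic_2_gradient_bound:
  assumes u: "T_harmonic 2 u" and bd: "\<And>z. norm z < 1 \<Longrightarrow> norm (u z) \<le> 1"
    and z: "norm z < 1"
  shows "onorm (frechet_derivative u (at z)) \<le> (2 + 5 * norm z) * (1 + (norm z)\<^sup>2) / (1 - (norm z)\<^sup>2)"
proof (rule onorm_le)
  fix h
  have "norm (frechet_derivative u (at z) h) \<le> circle_mean (\<lambda>\<zeta>. \<bar>T2_poisson_deriv z h \<zeta>\<bar>)"
    by (rule T_harmonic_2_derivative_bound[OF u bd z])
  also have "\<dots> \<le> circle_mean (\<lambda>\<zeta>. (2 + 5 * norm z) * norm h * (2 / (1 - (norm z)\<^sup>2)) * T2_poisson z \<zeta>)"
    by (rule circle_mean_mono[OF _ _ T2_poisson_deriv_bound[OF z]])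
      (intro continuous_on_rabs continuous_on_mult_left continuous_on_T2_poisson_deriv continuous_on_T2_poisson z)+
  also have "\<dots> = (2 + 5 * norm z) * norm h * (2 / (1 - (norm z)\<^sup>2)) * circle_mean (T2_poisson z)"
    by (rule circle_mean_linear[OF bounded_linear_mult_right continuous_on_T2_poisson[OF z]])
  also have "\<dots> = (2 + 5 * norm z) * (1 + (norm z)\<^sup>2) / (1 - (norm z)\<^sup>2) * norm h"
  proof -
    have "a * b * (2 / n) * (m / 2) = a * m / n * b" for a b n m :: real by simp
    thus ?thesis unfolding circle_mean_T2_poisson[OF z] .
  qed
  finally show "norm (frechet_derivative u (at z) h)
      \<le> (2 + 5 * norm z) * (1 + (norm z)\<^sup>2) / (1 - (norm z)\<^sup>2) * norm h" .
qed

section \<open>Gradient at the origin\<close>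

text \<open>
  For Laurent sums both sides are the constant coefficient; continuous functions follow by
  approximation.
\<close>
lemma circle_mean_rotate_complex:
  fixes f :: "complex \<Rightarrow> complex"
  assumes f: "continuous_on (sphere 0 1) f" and w: "norm w = 1"
  shows "circle_mean (\<lambda>\<zeta>. f (w * \<zeta>)) = circle_mean f"
proof -
  have fw: "continuous_on (sphere 0 1) (\<lambda>\<zeta>. g (w * \<zeta>))" if "continuous_on (sphere 0 1) g" for g :: "complex \<Rightarrow> complex"
    by (rule continuous_on_compose2[OF that])
      (use w in \<open>auto simp: norm_mult intro!: continuous_on_mult_left continuous_on_id\<close>)
  have "norm (circle_mean (\<lambda>\<zeta>. f (w * \<zeta>)) - circle_mean f) \<le> 0 + e" if e: "e > 0" for e
  proof -
    obtain K c where K: "finite K" and L: "\<And>\<zeta>. norm \<zeta> = 1 \<Longrightarrow> norm (f \<zeta> - laurent_sum K c \<zeta>) < e / 2"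
      using laurent_sum_approximation[OF f, of "e / 2"] e by auto
    note cL = continuous_on_laurent_sum[of K c]
    have mean: "circle_mean (laurent_sum K a) = (if 0 \<in> K then a 0 else 0)" for a
      using laurent_sum_coeff[OF K, of a 0] by simp
    have "circle_mean (\<lambda>\<zeta>. laurent_sum K c (w * \<zeta>)) = circle_mean (laurent_sum K (\<lambda>k. c k * w powi k))"
      unfolding laurent_sum_def by (simp add: power_int_mult_distrib mult.assoc)
    hence rot: "circle_mean (\<lambda>\<zeta>. laurent_sum K c (w * \<zeta>)) = circle_mean (laurent_sum K c)"
      unfolding mean by simp
    have "norm (circle_mean (\<lambda>\<zeta>. f (w * \<zeta>)) - circle_mean (\<lambda>\<zeta>. laurent_sum K c (w * \<zeta>))) \<le> circle_mean (\<lambda>_. e / 2)"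
      unfolding circle_mean_diff[OF fw[OF f] fw[OF cL], symmetric]
    proof (rule norm_circle_mean_le)
      fix \<zeta> :: complex assume "norm \<zeta> = 1"
      thus "norm (f (w * \<zeta>) - laurent_sum K c (w * \<zeta>)) \<le> e / 2"
        using L[of "w * \<zeta>"] w by (simp add: norm_mult)
    qed (intro continuous_on_diff continuous_on_const fw f cL)+
    moreover have "norm (circle_mean f - circle_mean (laurent_sum K c)) \<le> circle_mean (\<lambda>_. e / 2)"
      unfolding circle_mean_diff[OF f cL, symmetric]
    proof (rule norm_circle_mean_le)
      fix \<zeta> :: complex assume "norm \<zeta> = 1"
      thus "norm (f \<zeta> - laurent_sum K c \<zeta>) \<le> e / 2" using L[of \<zeta>] by simp
    qed (intro continuous_on_diff continuous_on_const f cL)+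
    ultimately show ?thesis
      using norm_triangle_ineq4[of "circle_mean (\<lambda>\<zeta>. f (w * \<zeta>)) - circle_mean (laurent_sum K c)"
          "circle_mean f - circle_mean (laurent_sum K c)"]
      unfolding circle_mean_const rot by simp
  qed
  hence "norm (circle_mean (\<lambda>\<zeta>. f (w * \<zeta>)) - circle_mean f) \<le> 0" by (rule field_le_epsilon)
  thus ?thesis by simp
qed

lemma circle_mean_abs_Re: "circle_mean (\<lambda>\<zeta>. \<bar>Re \<zeta>\<bar>) = 2 / pi"
proof -
  define F where "F = (\<lambda>t. sin (2 * pi * t) / (2 * pi))"
  have F: "((\<lambda>t. cos (2 * pi * t)) has_integral (F b - F a)) {a..b}" if "a \<le> b" for a b
    by (rule fundamental_theorem_of_calculus[OF that])
      (auto simp: F_def has_real_derivative_iff_has_vector_derivative[symmetric] intro!: derivative_eq_intros)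
  have vals: "F 0 = 0" "F (1/4) = 1 / (2 * pi)" "F (3/4) = - 1 / (2 * pi)" "F 1 = 0"
  proof -
    have "sin (2 * pi * (3/4)) = - 1"
      using sin_periodic_pi[of "pi / 2"] by (simp add: algebra_simps)
    thus "F (3/4) = - 1 / (2 * pi)" unfolding F_def by simp
  qed (simp_all add: F_def)
  have 1: "((\<lambda>t. \<bar>cos (2 * pi * t)\<bar>) has_integral (F (1/4) - F 0)) {0..1/4}"
  proof (rule has_integral_eq[OF _ F])
    fix t :: real assume "t \<in> {0..1/4}"
    hence "2 * pi * t \<le> 2 * pi * (1/4)" "2 * pi * 0 \<le> 2 * pi * t" by (intro mult_left_mono; simp)+
    hence "cos (2 * pi * t) \<ge> 0" by (intro cos_ge_zero) (use pi_gt_zero in linarith)+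
    thus "cos (2 * pi * t) = \<bar>cos (2 * pi * t)\<bar>" by simp
  qed simp
  have 2: "((\<lambda>t. \<bar>cos (2 * pi * t)\<bar>) has_integral - (F (3/4) - F (1/4))) {1/4..3/4}"
  proof (rule has_integral_eq[OF _ has_integral_neg[OF F]])
    fix t :: real assume "t \<in> {1/4..3/4}"
    hence "2 * pi * t \<le> 2 * pi * (3/4)" "2 * pi * (1/4) \<le> 2 * pi * t" by (intro mult_left_mono; simp)+
    hence "cos (2 * pi * t - pi) \<ge> 0" by (intro cos_ge_zero) (use pi_gt_zero in linarith)+
    thus "- cos (2 * pi * t) = \<bar>cos (2 * pi * t)\<bar>" by (simp add: cos_diff)
  qed simp
  have 3: "((\<lambda>t. \<bar>cos (2 * pi * t)\<bar>) has_integral (F 1 - F (3/4))) {3/4..1}"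
  proof (rule has_integral_eq[OF _ F])
    fix t :: real assume "t \<in> {3/4..1}"
    hence "2 * pi * t \<le> 2 * pi * 1" "2 * pi * (3/4) \<le> 2 * pi * t" by (intro mult_left_mono; simp)+
    hence "cos (2 * pi * t - 2 * pi) \<ge> 0" by (intro cos_ge_zero) (use pi_gt_zero in linarith)+
    thus "cos (2 * pi * t) = \<bar>cos (2 * pi * t)\<bar>" by (simp add: cos_diff)
  qed simp
  have "((\<lambda>t. \<bar>cos (2 * pi * t)\<bar>) has_integral
      (F (1/4) - F 0 + - (F (3/4) - F (1/4)) + (F 1 - F (3/4)))) {0..1}"
    by (rule has_integral_combine[OF _ _ has_integral_combine[OF _ _ 1 2] 3]) auto
  moreover have "F (1/4) - F 0 + - (F (3/4) - F (1/4)) + (F 1 - F (3/4)) = 2 / pi"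
    unfolding vals by (simp add: field_simps)
  moreover have "Re (circlepath 0 1 t) = cos (2 * pi * t)" for t
    unfolding circlepath by (simp add: Re_exp)
  ultimately show ?thesis unfolding circle_mean_def by (simp add: integral_unique)
qed

lemma circle_mean_abs_Re_cnj_mult: "circle_mean (\<lambda>\<zeta>. \<bar>Re (cnj \<zeta> * h)\<bar>) = 2 / pi * norm h"
proof (cases "h = 0")
  case False
  \<comment> \<open>A rotation by \<open>w\<close> reduces the direction \<open>h\<close> to a positive real one.\<close>
  define w where "w = cnj h / norm h"
  have w: "norm w = 1" unfolding w_def using False by (simp add: norm_divide)
  have "\<bar>Re (cnj \<zeta> * h)\<bar> = norm h * \<bar>Re (w * \<zeta>)\<bar>" for \<zeta>
  proof -
    have "norm h * Re (w * \<zeta>) = Re (of_real (norm h) * (w * \<zeta>))" by simp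
    also have "of_real (norm h) * (w * \<zeta>) = cnj (cnj \<zeta> * h)" unfolding w_def using False by (simp add: mult.commute)
    also have "Re (cnj (cnj \<zeta> * h)) = Re (cnj \<zeta> * h)" by (rule cnj.simps(1))
    finally show ?thesis by (metis abs_mult abs_norm_cancel)
  qed
  hence "circle_mean (\<lambda>\<zeta>. \<bar>Re (cnj \<zeta> * h)\<bar>) = norm h * circle_mean (\<lambda>\<zeta>. \<bar>Re (w * \<zeta>)\<bar>)"
    using circle_mean_linear[OF bounded_linear_mult_right, of "\<lambda>\<zeta>. \<bar>Re (w * \<zeta>)\<bar>" "norm h"]
    by (simp add: continuous_intros)
  moreover have "complex_of_real (circle_mean (\<lambda>\<zeta>. \<bar>Re (w * \<zeta>)\<bar>)) = of_real (circle_mean (\<lambda>\<zeta>. \<bar>Re \<zeta>\<bar>))"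
  proof -
    have "complex_of_real (circle_mean (\<lambda>\<zeta>. \<bar>Re (w * \<zeta>)\<bar>)) = circle_mean (\<lambda>\<zeta>. of_real \<bar>Re (w * \<zeta>)\<bar>)"
      by (rule circle_mean_linear[OF bounded_linear_of_real, symmetric]) (intro continuous_intros)
    also have "\<dots> = circle_mean (\<lambda>\<zeta>. of_real \<bar>Re \<zeta>\<bar>)"
      by (rule circle_mean_rotate_complex[of "\<lambda>\<zeta>. of_real \<bar>Re \<zeta>\<bar>", OF _ w]) (intro continuous_intros)
    also have "\<dots> = of_real (circle_mean (\<lambda>\<zeta>. \<bar>Re \<zeta>\<bar>))"
      by (rule circle_mean_linear[OF bounded_linear_of_real]) (intro continuous_intros)
    finally show ?thesis .
  qed
  ultimately show ?thesis by (simp only: of_real_eq_iff circle_mean_abs_Re mult.commute)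
qed (simp add: circle_mean_const)

text \<open>
  At \<open>0\<close> the derivative of the kernel is exactly \<open>2 Re (cnj \<zeta> h)\<close>, so the mean can be computed instead of
  estimated.
\<close>
lemma T_harmonic_2_gradient_bound_0:
  assumes u: "T_harmonic 2 u" and bd: "\<And>z. norm z < 1 \<Longrightarrow> norm (u z) \<le> 1"
  shows "onorm (frechet_derivative u (at 0)) \<le> 4 / pi"
proof (rule onorm_le)
  fix h
  have "norm (frechet_derivative u (at 0) h) \<le> circle_mean (\<lambda>\<zeta>. \<bar>T2_poisson_deriv 0 h \<zeta>\<bar>)"
    by (rule T_harmonic_2_derivative_bound[OF u bd]) simp_all
  also have "\<dots> = circle_mean (\<lambda>\<zeta>. 2 * \<bar>Re (cnj \<zeta> * h)\<bar>)"
  proof (rule circle_mean_cong)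
    fix \<zeta> :: complex assume "norm \<zeta> = 1"
    hence "T2_poisson_deriv 0 h \<zeta> = 2 * Re (cnj \<zeta> * h)"
      unfolding T2_poisson_deriv_def by (simp add: algebra_simps)
    thus "\<bar>T2_poisson_deriv 0 h \<zeta>\<bar> = 2 * \<bar>Re (cnj \<zeta> * h)\<bar>" by (simp only: abs_mult)
  qed
  also have "\<dots> = 2 * circle_mean (\<lambda>\<zeta>. \<bar>Re (cnj \<zeta> * h)\<bar>)"
    by (rule circle_mean_linear[OF bounded_linear_mult_right]) (intro continuous_intros)
  finally show "norm (frechet_derivative u (at 0) h) \<le> 4 / pi * norm h"
    unfolding circle_mean_abs_Re_cnj_mult by simp
qed

section \<open>Sharpness at the origin\<close>

text \<open>
  Only the modes \<open>z\<close> and \<open>cnj z\<close> have a nonzero derivative at \<open>0\<close>.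
\<close>
lemma wirtinger_T2_mode_0: "wirtinger (T2_mode k) (if k = 1 then 1 else 0) (if k = - 1 then 1 else 0) 0"
proof -
  have nat: "wirtinger (T2_mode (int n)) (if n = 1 then 1 else 0) 0 0" for n
  proof -
    have "wirtinger (\<lambda>z. ((of_nat n + 1) * z ^ n - (of_nat n - 1) * z ^ (n + 1) * cnj z) / 2)
        ((of_nat n + 1) * (of_nat n * 0 ^ (n - 1)) / 2) 0 0"
      unfolding wirtinger_def
      by (auto intro!: derivative_eq_intros simp: fun_eq_iff field_simps)
    moreover have "(of_nat n + 1) * (of_nat n * 0 ^ (n - 1)) / 2 = (if n = 1 then 1 else (0::complex))"
      by (cases n) auto
    ultimately show ?thesis unfolding T2_mode_of_nat[abs_def] by simp
  qed
  show ?thesis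
  proof (cases "k \<ge> 0")
    case True
    then obtain n where "k = int n" using zero_le_imp_eq_int by blast
    thus ?thesis using nat[of n] by simp
  next
    case False
    then obtain n where "- k = int n" using zero_le_imp_eq_int[of "- k"] by auto
    hence k: "k = - int n" by simp
    hence "T2_mode k = (\<lambda>z. cnj (T2_mode (int n) z))" using T2_mode_uminus[of "int n"] by auto
    thus ?thesis using wirtinger_cnj[OF nat[of n]] False unfolding k by (cases "n = 1") auto
  qed
qed

lemma wirtinger_sum:
  assumes "\<And>k. k \<in> K \<Longrightarrow> wirtinger (f k) (p k) (q k) z"
  shows "wirtinger (\<lambda>w. \<Sum>k\<in>K. c k * f k w) (\<Sum>k\<in>K. c k * p k) (\<Sum>k\<in>K. c k * q k) z"
  using assms
proof (induction K rule: infinite_finite_induct)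
  case (insert k K)
  have "wirtinger (\<lambda>w. c k * f k w + (\<Sum>k\<in>K. c k * f k w)) (c k * p k + (\<Sum>k\<in>K. c k * p k))
     (c k * q k + (\<Sum>k\<in>K. c k * q k)) z"
    by (intro wirtinger_add wirtinger_cmult insert) (use insert in auto)
  thus ?case using insert by simp
qed (simp_all add: wirtinger_const)

lemma frechet_derivative_mode_sum_0:
  assumes K: "finite K"
  shows "frechet_derivative (\<lambda>z. \<Sum>k\<in>K. c k * T2_mode k z) (at 0) 1
     = circle_mean (\<lambda>\<zeta>. laurent_sum K c \<zeta> * of_real (2 * Re \<zeta>))"
proof -
  have "frechet_derivative (\<lambda>z. \<Sum>k\<in>K. c k * T2_mode k z) (at 0) 1
      = (\<Sum>k\<in>K. c k * (if k = 1 then 1 else 0)) + (\<Sum>k\<in>K. c k * (if k = - 1 then 1 else 0))"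
    unfolding wirtinger_partials(2)[OF wirtinger_sum[OF wirtinger_T2_mode_0]] by simp
  also have "\<dots> = (if 1 \<in> K then c 1 else 0) + (if - 1 \<in> K then c (- 1) else 0)"
    using K by (simp add: if_distrib cong: if_cong)
  also have "\<dots> = circle_mean (\<lambda>\<zeta>. laurent_sum K c \<zeta> * \<zeta> powi (- 1)) + circle_mean (\<lambda>\<zeta>. laurent_sum K c \<zeta> * \<zeta> powi (- (- 1)))"
    unfolding laurent_sum_coeff[OF K] by simp
  also have "\<dots> = circle_mean (\<lambda>\<zeta>. laurent_sum K c \<zeta> * \<zeta> powi (- 1) + laurent_sum K c \<zeta> * \<zeta> powi (- (- 1)))"
    by (rule circle_mean_add[symmetric]) (intro continuous_on_mult continuous_on_laurent_sum continuous_on_powi)+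
  also have "\<dots> = circle_mean (\<lambda>\<zeta>. laurent_sum K c \<zeta> * of_real (2 * Re \<zeta>))"
  proof (rule circle_mean_cong)
    fix \<zeta> :: complex assume "norm \<zeta> = 1"
    hence "\<zeta> powi (- 1) + \<zeta> powi (- (- 1)) = of_real (2 * Re \<zeta>)"
      using powi_uminus_unit_circle[of \<zeta> 1] by (simp add: complex_eq_iff)
    thus "laurent_sum K c \<zeta> * \<zeta> powi (- 1) + laurent_sum K c \<zeta> * \<zeta> powi (- (- 1))
        = laurent_sum K c \<zeta> * of_real (2 * Re \<zeta>)"
      unfolding distrib_left[symmetric] by (rule arg_cong)
  qed
  finally show ?thesis .
qed

text \<open>
  The mean of the kernel is \<open>(1 + |z|\<^sup>2) / 2 < 1\<close>, which gives a strict bound inside the disk.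
\<close>
lemma mode_sum_bound:
  assumes K: "finite K" and L: "\<And>\<zeta>. norm \<zeta> = 1 \<Longrightarrow> norm (laurent_sum K c \<zeta>) \<le> M" and M: "M > 0"
    and z: "norm z < 1"
  shows "norm (\<Sum>k\<in>K. c k * T2_mode k z) < M"
proof -
  note cP = continuous_on_T2_poisson[OF z]
  have "norm (\<Sum>k\<in>K. c k * T2_mode k z) \<le> circle_mean (\<lambda>\<zeta>. M * T2_poisson z \<zeta>)"
    unfolding circle_mean_poisson_laurent[OF z K, symmetric]
  proof (rule norm_circle_mean_le)
    fix \<zeta> :: complex assume \<zeta>: "norm \<zeta> = 1"
    have "T2_poisson z \<zeta> \<ge> 0" unfolding T2_poisson_def using z by (simp add: abs_square_le_1)
    thus "norm (of_real (T2_poisson z \<zeta>) * laurent_sum K c \<zeta>) \<le> M * T2_poisson z \<zeta>"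
      using mult_left_mono[OF L[OF \<zeta>], of "T2_poisson z \<zeta>"] by (simp add: norm_mult mult.commute)
  qed (intro continuous_intros continuous_on_laurent_sum cP)+
  also have "\<dots> = M * ((1 + (norm z)\<^sup>2) / 2)"
    using circle_mean_linear[OF bounded_linear_mult_right cP] circle_mean_T2_poisson[OF z] by metis
  also have "\<dots> < M * 1"
    using z M by (intro mult_strict_left_mono) (simp_all add: power_less_one_iff abs_square_less_1)
  finally show ?thesis by simp
qed

text \<open>
  The boundary values \<open>sgn (Re \<zeta>)\<close> would give equality. They are replaced by the continuous function
  \<open>Re \<zeta> / (|Re \<zeta>| + \<delta>)\<close> and then by a Laurent sum within \<open>\<delta>\<close> of it, which makes the extension a finite sum
  of modes and hence plainly a solution; the division by \<open>1 + \<delta>\<close> brings its values back into the disk.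
\<close>
lemma near_extremal_exists:
  assumes \<delta>: "\<delta> > 0"
  obtains u where "T_harmonic 2 u" "u ` ball 0 1 \<subseteq> ball 0 1"
    "(4 / pi - 4 * \<delta>) / (1 + \<delta>) \<le> onorm (frechet_derivative u (at 0))"
proof -
  define f :: "complex \<Rightarrow> complex" where "f = (\<lambda>\<zeta>. of_real (Re \<zeta> / (\<bar>Re \<zeta>\<bar> + \<delta>)))"
  have f1: "norm (f \<zeta>) \<le> 1" for \<zeta> unfolding f_def norm_of_real using \<delta> by (simp add: abs_divide field_simps)
  have "continuous_on (sphere 0 1) f"
    unfolding f_def by (intro continuous_intros) (use \<delta> in \<open>auto simp: add_nonneg_eq_0_iff\<close>)
  then obtain K c where K: "finite K" and L: "\<And>\<zeta>. norm \<zeta> = 1 \<Longrightarrow> norm (f \<zeta> - laurent_sum K c \<zeta>) < \<delta>"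
    using laurent_sum_approximation \<delta> by blast
  have L1: "norm (laurent_sum K c \<zeta>) \<le> 1 + \<delta>" if "norm \<zeta> = 1" for \<zeta>
    using L[OF that] f1[of \<zeta>] norm_triangle_ineq3[of "f \<zeta>" "laurent_sum K c \<zeta>"] by linarith
  define V where "V = (\<lambda>z. \<Sum>k\<in>K. c k * T2_mode k z)"
  define u where "u = (\<lambda>z. of_real (1 / (1 + \<delta>)) * V z)"
  have V: "T_harmonic 2 V" unfolding V_def by (intro T_harmonic_2_sum T_harmonic_T2_mode)
  have u: "T_harmonic 2 u" unfolding u_def using T_harmonic_2_linear[OF V V, of "of_real (1 / (1 + \<delta>))" 0] by simp
  have range: "u ` ball 0 1 \<subseteq> ball 0 1"
  proof
    fix x assume "x \<in> u ` ball 0 1"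
    then obtain z where z: "norm z < 1" "x = u z" by auto
    have "norm (V z) < 1 + \<delta>" unfolding V_def by (rule mode_sum_bound[OF K L1]) (use \<delta> z in auto)
    thus "x \<in> ball 0 1" using \<delta> unfolding z(2) u_def by (simp add: norm_mult norm_divide field_simps del: of_real_add of_real_divide)
  qed
  have "circle_mean (\<lambda>\<zeta>. 2 * \<bar>Re \<zeta>\<bar>) - circle_mean (\<lambda>_. 4 * \<delta>)
      = circle_mean (\<lambda>\<zeta>. 2 * \<bar>Re \<zeta>\<bar> - 4 * \<delta>)"
    by (rule circle_mean_diff[symmetric]) (intro continuous_intros)+
  also have "\<dots> \<le> circle_mean (\<lambda>\<zeta>. Re (laurent_sum K c \<zeta> * of_real (2 * Re \<zeta>)))"
  proof (rule circle_mean_mono)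
    fix \<zeta> :: complex assume \<zeta>: "norm \<zeta> = 1"
    define x where "x = Re \<zeta>"
    have x: "\<bar>x\<bar> \<le> 1" unfolding x_def using abs_Re_le_cmod[of \<zeta>] \<zeta> by simp
    have "(\<bar>x\<bar> - \<delta>) * (\<bar>x\<bar> + \<delta>) \<le> x * x" by (simp add: algebra_simps)
    hence fx: "\<bar>x\<bar> - \<delta> \<le> x / (\<bar>x\<bar> + \<delta>) * x" using \<delta> by (simp add: field_simps)
    have "\<bar>Re (f \<zeta> - laurent_sum K c \<zeta>) * x\<bar> \<le> \<delta> * 1"
      unfolding abs_mult using x L[OF \<zeta>] abs_Re_le_cmod[of "f \<zeta> - laurent_sum K c \<zeta>"] \<delta>
      by (intro mult_mono) auto
    hence "Re (laurent_sum K c \<zeta>) * x \<ge> Re (f \<zeta>) * x - \<delta>"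
      unfolding minus_complex.sel left_diff_distrib by linarith
    moreover have "Re (f \<zeta>) * x = x / (\<bar>x\<bar> + \<delta>) * x" unfolding f_def x_def by simp
    ultimately have "2 * \<bar>x\<bar> - 4 * \<delta> \<le> 2 * (Re (laurent_sum K c \<zeta>) * x)" using fx by linarith
    thus "2 * \<bar>Re \<zeta>\<bar> - 4 * \<delta> \<le> Re (laurent_sum K c \<zeta> * of_real (2 * Re \<zeta>))"
      unfolding x_def by simp
  qed (intro continuous_intros continuous_on_laurent_sum)+
  also have "\<dots> = Re (circle_mean (\<lambda>\<zeta>. laurent_sum K c \<zeta> * of_real (2 * Re \<zeta>)))"
    by (rule circle_mean_linear[OF bounded_linear_Re]) (intro continuous_intros continuous_on_laurent_sum)
  also have "\<dots> \<le> norm (frechet_derivative V (at 0) 1)"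
    unfolding V_def frechet_derivative_mode_sum_0[OF K] by (rule complex_Re_le_cmod)
  also have "circle_mean (\<lambda>\<zeta>. 2 * \<bar>Re \<zeta>\<bar>) = 2 * circle_mean (\<lambda>\<zeta>. \<bar>Re \<zeta>\<bar>)"
    by (rule circle_mean_linear[OF bounded_linear_mult_right]) (intro continuous_intros)
  finally have DV: "4 / pi - 4 * \<delta> \<le> norm (frechet_derivative V (at 0) 1)"
    unfolding circle_mean_abs_Re circle_mean_const by simp
  have wV: "wirtinger V (d_z V 0) (d_zbar V 0) 0" by (rule T_harmonic_2D(3)[OF V]) simp
  have wu: "wirtinger u (of_real (1 / (1 + \<delta>)) * d_z V 0) (of_real (1 / (1 + \<delta>)) * d_zbar V 0) 0"
    unfolding u_def by (rule wirtinger_cmult[OF wV])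
  have "frechet_derivative u (at 0) 1 = of_real (1 / (1 + \<delta>)) * frechet_derivative V (at 0) 1"
    unfolding wirtinger_partials(2)[OF wV] wirtinger_partials(2)[OF wu] by (simp add: algebra_simps)
  hence "norm (frechet_derivative u (at 0) 1) = norm (frechet_derivative V (at 0) 1) / (1 + \<delta>)"
    using \<delta> by (simp add: norm_mult del: of_real_divide of_real_add)
  moreover have "(4 / pi - 4 * \<delta>) / (1 + \<delta>) \<le> norm (frechet_derivative V (at 0) 1) / (1 + \<delta>)"
    using DV \<delta> by (intro divide_right_mono) auto
  moreover have "norm (frechet_derivative u (at 0) 1) \<le> onorm (frechet_derivative u (at 0)) * norm (1::complex)"
    using wirtinger_partials(1)[OF wu] frechet_derivative_works has_derivative_bounded_linear
    by (intro onorm) blast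
  ultimately have "(4 / pi - 4 * \<delta>) / (1 + \<delta>) \<le> onorm (frechet_derivative u (at 0))" by simp
  thus ?thesis by (rule that[OF u range])
qed

theorem theorem2:
  shows "(\<forall>u :: complex \<Rightarrow> complex. T_harmonic 2 u \<and> u ` ball 0 1 \<subseteq> ball 0 1 \<longrightarrow>
            (\<forall>z\<in>ball 0 1. onorm (frechet_derivative u (at z))
                 \<le> (2 + 5 * norm z) * (1 + (norm z)\<^sup>2) / (1 - (norm z)\<^sup>2)) \<and>
            onorm (frechet_derivative u (at 0)) \<le> 4 / pi) \<and>
         \<not> (\<exists>C :: real. C < 4 / pi \<and>
              (\<forall>u :: complex \<Rightarrow> complex. T_harmonic 2 u \<and> u ` ball 0 1 \<subseteq> ball 0 1 \<longrightarrow>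
                 onorm (frechet_derivative u (at 0)) \<le> C))"
proof (rule conjI)
  show "\<forall>u :: complex \<Rightarrow> complex. T_harmonic 2 u \<and> u ` ball 0 1 \<subseteq> ball 0 1 \<longrightarrow>
            (\<forall>z\<in>ball 0 1. onorm (frechet_derivative u (at z))
                 \<le> (2 + 5 * norm z) * (1 + (norm z)\<^sup>2) / (1 - (norm z)\<^sup>2)) \<and>
            onorm (frechet_derivative u (at 0)) \<le> 4 / pi"
  proof (intro allI impI)
    fix u :: "complex \<Rightarrow> complex" assume "T_harmonic 2 u \<and> u ` ball 0 1 \<subseteq> ball 0 1"
    hence u: "T_harmonic 2 u" and "\<And>z. norm z < 1 \<Longrightarrow> norm (u z) < 1"
      by (auto simp: image_subset_iff)
    hence bd: "\<And>z. norm z < 1 \<Longrightarrow> norm (u z) \<le> 1" by (simp add: less_imp_le)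
    show "(\<forall>z\<in>ball 0 1. onorm (frechet_derivative u (at z))
                 \<le> (2 + 5 * norm z) * (1 + (norm z)\<^sup>2) / (1 - (norm z)\<^sup>2)) \<and>
            onorm (frechet_derivative u (at 0)) \<le> 4 / pi"
      using T_harmonic_2_gradient_bound[OF u bd] T_harmonic_2_gradient_bound_0[OF u bd] by simp
  qed
  show "\<not> (\<exists>C :: real. C < 4 / pi \<and>
              (\<forall>u :: complex \<Rightarrow> complex. T_harmonic 2 u \<and> u ` ball 0 1 \<subseteq> ball 0 1 \<longrightarrow>
                 onorm (frechet_derivative u (at 0)) \<le> C))"
  proof
    assume "\<exists>C :: real. C < 4 / pi \<and>
              (\<forall>u :: complex \<Rightarrow> complex. T_harmonic 2 u \<and> u ` ball 0 1 \<subseteq> ball 0 1 \<longrightarrow>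
                 onorm (frechet_derivative u (at 0)) \<le> C)"
    then obtain C where C: "C < 4 / pi" "\<And>u. T_harmonic 2 u \<Longrightarrow> u ` ball 0 1 \<subseteq> ball 0 1 \<Longrightarrow>
        onorm (frechet_derivative u (at 0)) \<le> C" by blast
    have bound: "(4 / pi - 4 * \<delta>) / (1 + \<delta>) \<le> C" if "\<delta> > 0" for \<delta>
      using near_extremal_exists[OF that] C(2) order_trans by metis
    have "4 / pi \<le> C"
    proof (rule tendsto_upperbound)
      have "((\<lambda>\<delta>. (4 / pi - 4 * \<delta>) / (1 + \<delta>)) \<longlongrightarrow> (4 / pi - 4 * 0) / (1 + 0)) (at_right 0)"
        by (intro tendsto_intros) simp
      thus "((\<lambda>\<delta>. (4 / pi - 4 * \<delta>) / (1 + \<delta>)) \<longlongrightarrow> 4 / pi) (at_right 0)" by simp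
      show "\<forall>\<^sub>F \<delta> in at_right 0. (4 / pi - 4 * \<delta>) / (1 + \<delta>) \<le> C"
        by (rule eventually_at_rightI[of 0 1]) (use bound in auto)
    qed simp
    with C(1) show False by simp
  qed
qed

end
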